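(* Let $Q$ be a finite Leibniz conformal algebra which is free as a $\mathbf{k}[\partial]$-module and let $r\in Q\otimes Q$. Then $r$ is a solution of the classical Leibniz conformal Yang-Baxter equation (CLCYBE) in $Q$ if and only if $\sigma(\tau r)\in\mathrm{Chom}(Q^{*c},Q)$ satisfies $$[{\sigma(\tau r)_0x}_\lambda\,\sigma(\tau r)_0y]=\sigma(\tau r)_0\big(L^*(\sigma(r)_0x)_\lambda y-(L^*+R^* )(\sigma(\tau r)_0y)_{-\lambda-\partial}x\big)\quad\text{for all }x,y\in Q^{*c}.$$ Moreover, if $r-\tau r$ is invariant, then $r$ is a solution of the CLCYBE in $Q$ if and only if $\sigma(r)$ satisfies $$[{\sigma(r)_0x}_\lambda\,\sigma(r)_0y]=\sigma(r)_0\big(L^*(\sigma(r)_0x)_\lambda y-(L^*+R^* )(\sigma(\tau r)_0y)_{-\lambda-\partial}x\big)\quad\text{for all }x,y\in Q^{*c}.$$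
   Context: $\mathbf{k}$ is a field of characteristic zero; tensors are over $\mathbf{k}$; $\tau(a\otimes b)=b\otimes a$; $\partial^{\otimes^2}=\partial\otimes\mathrm{id}+\mathrm{id}\otimes\partial$; on $Q^{\otimes3}$, $\partial_1,\partial_2,\partial_3$ denote $\partial$ acting on the first, second, third factor and $\partial^{\otimes^3}=\partial_1+\partial_2+\partial_3$. A Leibniz conformal algebra is a $\mathbf{k}[\partial]$-module $Q$ with a $\mathbf{k}$-bilinear map $[\cdot_\lambda\cdot]:Q\times Q\to Q[\lambda]$ with $[\partial a_\lambda b]=-\lambda[a_\lambda b]$, $[a_\lambda\partial b]=(\lambda+\partial)[a_\lambda b]$, $[a_\lambda[b_\mu c]]=[[a_\lambda b]_{\lambda+\mu}c]+[b_\mu[a_\lambda c]]$. Finite means finitely generated over $\mathbf{k}[\partial]$. Put $L(a)_\lambda b=[a_\lambda b]$, $R(a)_\lambda b=[b_{-\lambda-\partial}a]$. Substitution convention: when a formal variable in a polynomial with module coefficients is replaced by an expression containing $\partial$, $\partial^{\otimes^2}$ or $\partial_i$, one first computes the polynomial and then lets the expression act on its coefficients. For $\mathbf{k}[\partial]$-modules $U,V$, $\mathrm{Chom}(U,V)$ is the $\mathbf{k}[\partial]$-module of conformal linear maps: $\mathbf{k}$-linear $a_\lambda:U\to V[\lambda]$ with $a_\lambda(\partial u)=(\lambda+\partial)a_\lambda u$, where $(\partial a)_\lambda u=-\lambda a_\lambda u$; $\mathrm{Cend}(V)=\mathrm{Chom}(V,V)$; $U^{*c}=\mathrm{Chom}(U,\mathbf{k})$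 with $\mathbf{k}$ the trivial module; $\langle f,u\rangle_\lambda=f_\lambda u$ and $\langle f\otimes g,a\otimes b\rangle_{\lambda,\mu}=\langle f,a\rangle_\lambda\langle g,b\rangle_\mu$. $L^*,R^*:Q\to\mathrm{Cend}(Q^{*c})$ are given by $\langle L^*(a)_\lambda f,b\rangle_\mu=-\langle f,L(a)_\lambda b\rangle_{\mu-\lambda}$, $\langle R^*(a)_\lambda f,b\rangle_\mu=-\langle f,R(a)_\lambda b\rangle_{\mu-\lambda}$. $\sigma:Q\otimes Q\to\mathrm{Chom}(Q^{*c},Q)$ is the linear map defined by $\langle f,\sigma(a\otimes b)_\lambda g\rangle_\mu=\langle g\otimes f,a\otimes b\rangle_{-\lambda-\mu,\mu}$ for $f,g\in Q^{*c}$; equivalently $\sigma(a\otimes b)_\lambda g=\langle g,a\rangle_{-\lambda-\partial}\,b$ with $\partial$ acting on $b$. $\sigma(r)_0=\sigma(r)_\lambda|_{\lambda=0}$. For $a\in Q$, $F(a)=\big(L(a)_\lambda\otimes\mathrm{id}+R(a)_\lambda\otimes\mathrm{id}-\mathrm{id}\otimes R(a)_\lambda\big)|_{\lambda=-\partial^{\otimes^2}}\in\mathrm{End}_{\mathbf{k}}(Q\otimes Q)$; $s\in Q\otimes Q$ is invariant if $F(a)s=0$ for all $a\in Q$. CLCYBE: for $r=\sum_ia_i\otimes b_i$ put $$[[r,r]]=\sum_{i,j}[{a_i}_\mu a_j]\otimes b_i\otimes b_j|_{\mu=\partial_2}+\sum_{i,j}a_i\otimes a_j\otimes[{b_j}_\mu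 b_i]|_{\mu=\partial_2}-\sum_{i,j}a_i\otimes[{b_i}_\mu a_j]\otimes b_j|_{\mu=\partial_1}-\sum_{i,j}a_i\otimes[{a_j}_\mu b_i]\otimes b_j|_{\mu=-\partial_1-\partial_2}.$$ $r$ is a solution of the CLCYBE in $Q$ if $[[r,r]]\in\partial^{\otimes^3}(Q\otimes Q\otimes Q)$. *)

theory Defs
  imports
    "HOL-Computational_Algebra.Polynomial"
    "HOL-Library.Function_Algebras"
begin

section \<open>Modules over \<open>k[\<partial>]\<close>\<close>

text \<open>
  A \<open>k[\<partial>]\<close>-module is a library \<^locale>\<open>module\<close> whose scalars are of type \<open>'k poly\<close>;
  \<open>act p a\<close> is \<open>p(\<partial>) a\<close>. Thus \<open>k\<close> acts through the constant polynomials and \<open>\<partial>\<close> through the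
  indeterminate.
\<close>

definition smul :: "('k::field poly \<Rightarrow> 'v \<Rightarrow> 'v) \<Rightarrow> 'k \<Rightarrow> 'v \<Rightarrow> 'v"
  where "smul act c v = act [:c:] v"

definition der :: "('k::field poly \<Rightarrow> 'v \<Rightarrow> 'v) \<Rightarrow> 'v \<Rightarrow> 'v"
  where "der act v = act [:0, 1:] v"

definition fg_module :: "('k::field poly \<Rightarrow> 'v::ab_group_add \<Rightarrow> 'v) \<Rightarrow> bool"
  where "fg_module act \<longleftrightarrow> module act \<and> (\<exists>S. finite S \<and> module.span act S = UNIV)"

definition free_module :: "('k::field poly \<Rightarrow> 'v::ab_group_add \<Rightarrow> 'v) \<Rightarrow> bool"
  where "free_module act \<longleftrightarrow>
    module act \<and> (\<exists>B. \<not> module.dependent act B \<and> module.span act B = UNIV)"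

definition triv_act :: "'k::field poly \<Rightarrow> 'k \<Rightarrow> 'k"
  where "triv_act p c = poly p 0 * c"


section \<open>Polynomials with module coefficients\<close>

text \<open>
  \<open>V[\<lambda>]\<close> is \<open>'v poly\<close>. Substitution of the operator \<open>E\<close> for the variable of \<open>p\<close>: the coefficients
  of \<open>p\<close> are first sent to the target by \<open>i\<close>, and then \<open>E\<close> acts on them.
\<close>

definition psubst :: "('v::zero \<Rightarrow> 'w::comm_monoid_add) \<Rightarrow> ('w \<Rightarrow> 'w) \<Rightarrow> 'v poly \<Rightarrow> 'w"
  where "psubst i E p = (\<Sum>n\<le>degree p. (E ^^ n) (i (coeff p n)))"

definition const1 :: "'v::zero \<Rightarrow> 'v poly"
  where "const1 v = [:v:]"

text \<open>Multiplication by \<open>\<lambda> + \<partial>\<close> and by \<open>- \<lambda> - \<partial>\<close> on \<open>V[\<lambda>]\<close>.\<close>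

definition lam_der :: "('v::ab_group_add \<Rightarrow> 'v) \<Rightarrow> 'v poly \<Rightarrow> 'v poly"
  where "lam_der d p = pCons 0 p + map_poly d p"

definition neg_lam_der :: "('v::ab_group_add \<Rightarrow> 'v) \<Rightarrow> 'v poly \<Rightarrow> 'v poly"
  where "neg_lam_der d p = - pCons 0 p - map_poly d p"

text \<open>
  \<open>V[\<lambda>, \<mu>]\<close> is \<open>'v poly poly\<close> with \<open>\<lambda>\<close> the outer and \<open>\<mu>\<close> the inner variable; \<open>mul_lam\<close> and
  \<open>mul_mu\<close> are the multiplications by \<open>\<lambda>\<close> and \<open>\<mu>\<close>.
\<close>

definition const2 :: "'v::zero \<Rightarrow> 'v poly poly"
  where "const2 v = [:[:v:]:]"

definition mul_lam :: "'v::ab_group_add poly poly \<Rightarrow> 'v poly poly"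
  where "mul_lam p = pCons 0 p"

definition mul_mu :: "'v::ab_group_add poly poly \<Rightarrow> 'v poly poly"
  where "mul_mu p = map_poly (pCons 0) p"


section \<open>Bilinear and trilinear maps, Leibniz conformal algebras\<close>

definition bilinear_map ::
  "('k::field poly \<Rightarrow> 'q::ab_group_add \<Rightarrow> 'q) \<Rightarrow> ('k \<Rightarrow> 'w::ab_group_add \<Rightarrow> 'w) \<Rightarrow> ('q \<Rightarrow> 'q \<Rightarrow> 'w) \<Rightarrow> bool"
  where "bilinear_map act s \<beta> \<longleftrightarrow>
    (\<forall>b. Vector_Spaces.linear (smul act) s (\<lambda>a. \<beta> a b)) \<and>
    (\<forall>a. Vector_Spaces.linear (smul act) s (\<lambda>b. \<beta> a b))"

definition trilinear_map ::
  "('k::field poly \<Rightarrow> 'q::ab_group_add \<Rightarrow> 'q) \<Rightarrow> ('k \<Rightarrow> 'w::ab_group_add \<Rightarrow> 'w) \<Rightarrow>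
    ('q \<Rightarrow> 'q \<Rightarrow> 'q \<Rightarrow> 'w) \<Rightarrow> bool"
  where "trilinear_map act s \<beta> \<longleftrightarrow>
    (\<forall>b c. Vector_Spaces.linear (smul act) s (\<lambda>a. \<beta> a b c)) \<and>
    (\<forall>a c. Vector_Spaces.linear (smul act) s (\<lambda>b. \<beta> a b c)) \<and>
    (\<forall>a b. Vector_Spaces.linear (smul act) s (\<lambda>c. \<beta> a b c))"

text \<open>\<open>br a b\<close> is \<open>[a\<^sub>\<lambda> b] \<in> Q[\<lambda>]\<close>. The Jacobi identity is an identity in \<open>Q[\<lambda>, \<mu>]\<close>.\<close>

locale leibniz_conformal_algebra = module act
  for act :: "'k::field_char_0 poly \<Rightarrow> 'q::ab_group_add \<Rightarrow> 'q" +
  fixes br :: "'q \<Rightarrow> 'q \<Rightarrow> 'q poly"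
  assumes br_bilinear: "bilinear_map act (\<lambda>c. map_poly (smul act c)) br"
    and br_der_left: "br (der act a) b = - pCons 0 (br a b)"
    and br_der_right: "br a (der act b) = lam_der (der act) (br a b)"
    and br_jacobi:
      "psubst (\<lambda>x. psubst const2 mul_lam (br a x)) mul_mu (br b c) =
       psubst (\<lambda>x. psubst const2 (\<lambda>p. mul_lam p + mul_mu p) (br x c)) mul_lam (br a b) +
       psubst (\<lambda>x. psubst const2 mul_mu (br b x)) mul_lam (br a c)"

definition Lop :: "('q \<Rightarrow> 'q \<Rightarrow> 'q poly) \<Rightarrow> 'q \<Rightarrow> 'q::ab_group_add \<Rightarrow> 'q poly"
  where "Lop br a b = br a b"

definition Rop ::
  "('k::field poly \<Rightarrow> 'q \<Rightarrow> 'q) \<Rightarrow> ('q \<Rightarrow> 'q \<Rightarrow> 'q poly) \<Rightarrow> 'q \<Rightarrow> 'q::ab_group_add \<Rightarrow> 'q poly"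
  where "Rop act br a b = psubst const1 (neg_lam_der (der act)) (br b a)"


section \<open>Tensor products over \<open>k\<close>\<close>

text \<open>
  \<open>Q \<otimes> Q\<close> is realised inside the linear dual of the space of bilinear forms on \<open>Q\<close>, as the set of
  finite sums of the evaluations \<open>B \<mapsto> B a b\<close> (which are 0 by convention on maps that are not
  bilinear). Over a field this is the tensor product; its universal property is proved
  below. \<open>Q \<otimes> Q \<otimes> Q\<close> is obtained in the same way from trilinear forms.
\<close>

type_synonym ('k, 'q) tens2 = "('q \<Rightarrow> 'q \<Rightarrow> 'k) \<Rightarrow> 'k"
type_synonym ('k, 'q) tens3 = "('q \<Rightarrow> 'q \<Rightarrow> 'q \<Rightarrow> 'k) \<Rightarrow> 'k"

definition tens2 ::
  "('k::field poly \<Rightarrow> 'q::ab_group_add \<Rightarrow> 'q) \<Rightarrow> 'q \<Rightarrow> 'q \<Rightarrow> ('k, 'q) tens2"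
  where "tens2 act a b = (\<lambda>B. if bilinear_map act (*) B then B a b else 0)"

definition tens3 ::
  "('k::field poly \<Rightarrow> 'q::ab_group_add \<Rightarrow> 'q) \<Rightarrow> 'q \<Rightarrow> 'q \<Rightarrow> 'q \<Rightarrow> ('k, 'q) tens3"
  where "tens3 act a b c = (\<lambda>T. if trilinear_map act (*) T then T a b c else 0)"

definition tsum2 ::
  "('k::field poly \<Rightarrow> 'q::ab_group_add \<Rightarrow> 'q) \<Rightarrow> ('q \<times> 'q) list \<Rightarrow> ('k, 'q) tens2"
  where "tsum2 act xs = (\<Sum>(a, b)\<leftarrow>xs. tens2 act a b)"

definition tsum3 ::
  "('k::field poly \<Rightarrow> 'q::ab_group_add \<Rightarrow> 'q) \<Rightarrow> ('q \<times> 'q \<times> 'q) list \<Rightarrow> ('k, 'q) tens3"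
  where "tsum3 act xs = (\<Sum>(a, b, c)\<leftarrow>xs. tens3 act a b c)"

definition tensor2 :: "('k::field poly \<Rightarrow> 'q::ab_group_add \<Rightarrow> 'q) \<Rightarrow> ('k, 'q) tens2 set"
  where "tensor2 act = range (tsum2 act)"

definition tensor3 :: "('k::field poly \<Rightarrow> 'q::ab_group_add \<Rightarrow> 'q) \<Rightarrow> ('k, 'q) tens3 set"
  where "tensor3 act = range (tsum3 act)"

text \<open>
  \<open>lift2 act \<beta>\<close> is the linear map on \<open>Q \<otimes> Q\<close> with \<open>a \<otimes> b \<mapsto> \<beta> a b\<close>. For bilinear \<open>\<beta>\<close>
  the chosen representation is immaterial (\<open>lift2_tsum2\<close>, \<open>lift3_tsum3\<close> below).
\<close>

definition lift2 ::
  "('k::field poly \<Rightarrow> 'q::ab_group_add \<Rightarrow> 'q) \<Rightarrow> ('q \<Rightarrow> 'q \<Rightarrow> 'w::monoid_add) \<Rightarrow> ('k, 'q) tens2 \<Rightarrow> 'w"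
  where "lift2 act \<beta> t = (\<Sum>(a, b)\<leftarrow>(SOME xs. tsum2 act xs = t). \<beta> a b)"

definition lift3 ::
  "('k::field poly \<Rightarrow> 'q::ab_group_add \<Rightarrow> 'q) \<Rightarrow> ('q \<Rightarrow> 'q \<Rightarrow> 'q \<Rightarrow> 'w::monoid_add) \<Rightarrow>
    ('k, 'q) tens3 \<Rightarrow> 'w"
  where "lift3 act \<beta> t = (\<Sum>(a, b, c)\<leftarrow>(SOME xs. tsum3 act xs = t). \<beta> a b c)"

definition tau :: "('k::field poly \<Rightarrow> 'q::ab_group_add \<Rightarrow> 'q) \<Rightarrow> ('k, 'q) tens2 \<Rightarrow> ('k, 'q) tens2"
  where "tau act = lift2 act (\<lambda>a b. tens2 act b a)"

definition der2 :: "('k::field poly \<Rightarrow> 'q::ab_group_add \<Rightarrow> 'q) \<Rightarrow> ('k, 'q) tens2 \<Rightarrow> ('k, 'q) tens2"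
  where "der2 act = lift2 act (\<lambda>a b. tens2 act (der act a) b + tens2 act a (der act b))"

definition der3_1 :: "('k::field poly \<Rightarrow> 'q::ab_group_add \<Rightarrow> 'q) \<Rightarrow> ('k, 'q) tens3 \<Rightarrow> ('k, 'q) tens3"
  where "der3_1 act = lift3 act (\<lambda>a b c. tens3 act (der act a) b c)"

definition der3_2 :: "('k::field poly \<Rightarrow> 'q::ab_group_add \<Rightarrow> 'q) \<Rightarrow> ('k, 'q) tens3 \<Rightarrow> ('k, 'q) tens3"
  where "der3_2 act = lift3 act (\<lambda>a b c. tens3 act a (der act b) c)"

definition der3_3 :: "('k::field poly \<Rightarrow> 'q::ab_group_add \<Rightarrow> 'q) \<Rightarrow> ('k, 'q) tens3 \<Rightarrow> ('k, 'q) tens3"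
  where "der3_3 act = lift3 act (\<lambda>a b c. tens3 act a b (der act c))"

definition der3 :: "('k::field poly \<Rightarrow> 'q::ab_group_add \<Rightarrow> 'q) \<Rightarrow> ('k, 'q) tens3 \<Rightarrow> ('k, 'q) tens3"
  where "der3 act t = der3_1 act t + der3_2 act t + der3_3 act t"


section \<open>Invariance and the classical Leibniz conformal Yang-Baxter equation\<close>

definition Fop ::
  "('k::field poly \<Rightarrow> 'q::ab_group_add \<Rightarrow> 'q) \<Rightarrow> ('q \<Rightarrow> 'q \<Rightarrow> 'q poly) \<Rightarrow> 'q \<Rightarrow>
    ('k, 'q) tens2 \<Rightarrow> ('k, 'q) tens2"
  where "Fop act br a = lift2 act (\<lambda>x y.
      psubst (\<lambda>z. tens2 act z y) (\<lambda>t. - der2 act t) (Lop br a x)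
    + psubst (\<lambda>z. tens2 act z y) (\<lambda>t. - der2 act t) (Rop act br a x)
    - psubst (\<lambda>z. tens2 act x z) (\<lambda>t. - der2 act t) (Rop act br a y))"

definition invariant_tensor ::
  "('k::field poly \<Rightarrow> 'q::ab_group_add \<Rightarrow> 'q) \<Rightarrow> ('q \<Rightarrow> 'q \<Rightarrow> 'q poly) \<Rightarrow> ('k, 'q) tens2 \<Rightarrow> bool"
  where "invariant_tensor act br s \<longleftrightarrow> (\<forall>a. Fop act br a s = 0)"

text \<open>\<open>[[r, r]]\<close>; here \<open>a, b\<close> play the role of \<open>a\<^sub>i, b\<^sub>i\<close> and \<open>a', b'\<close> that of \<open>a\<^sub>j, b\<^sub>j\<close>.\<close>

definition clcybe ::
  "('k::field poly \<Rightarrow> 'q::ab_group_add \<Rightarrow> 'q) \<Rightarrow> ('q \<Rightarrow> 'q \<Rightarrow> 'q poly) \<Rightarrow> ('k, 'q) tens2 \<Rightarrow> ('k, 'q) tens3"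
  where "clcybe act br r = lift2 act (\<lambda>a b. lift2 act (\<lambda>a' b'.
      psubst (\<lambda>x. tens3 act x b b') (der3_2 act) (br a a')
    + psubst (\<lambda>x. tens3 act a a' x) (der3_2 act) (br b' b)
    - psubst (\<lambda>x. tens3 act a x b') (der3_1 act) (br b a')
    - psubst (\<lambda>x. tens3 act a x b') (\<lambda>t. - der3_1 act t - der3_2 act t) (br a' b)) r) r"

definition clcybe_solution ::
  "('k::field poly \<Rightarrow> 'q::ab_group_add \<Rightarrow> 'q) \<Rightarrow> ('q \<Rightarrow> 'q \<Rightarrow> 'q poly) \<Rightarrow> ('k, 'q) tens2 \<Rightarrow> bool"
  where "clcybe_solution act br r \<longleftrightarrow> clcybe act br r \<in> der3 act ` tensor3 act"


section \<open>Conformal linear maps, the conformal dual and \<open>\<sigma>\<close>\<close>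

text \<open>
  The source of a conformal linear map is a submodule \<open>U\<close> of a type; only the values on \<open>U\<close>
  matter. \<open>a u\<close> is \<open>a\<^sub>\<lambda> u \<in> V[\<lambda>]\<close>.
\<close>

definition Chom ::
  "'u::ab_group_add set \<Rightarrow> ('k::field poly \<Rightarrow> 'u \<Rightarrow> 'u) \<Rightarrow>
    ('k poly \<Rightarrow> 'v::ab_group_add \<Rightarrow> 'v) \<Rightarrow> ('u \<Rightarrow> 'v poly) set"
  where "Chom U actU actV = {a.
    (\<forall>u\<in>U. \<forall>v\<in>U. a (u + v) = a u + a v) \<and>
    (\<forall>c. \<forall>u\<in>U. a (smul actU c u) = map_poly (smul actV c) (a u)) \<and>
    (\<forall>u\<in>U. a (der actU u) = lam_der (der actV) (a u))}"

definition cdual :: "('k::field poly \<Rightarrow> 'q::ab_group_add \<Rightarrow> 'q) \<Rightarrow> ('q \<Rightarrow> 'k poly) set"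
  where "cdual act = Chom UNIV act triv_act"

text \<open>The module structure \<open>(p(\<partial>) f)\<^sub>\<lambda> u = p(- \<lambda>) f\<^sub>\<lambda> u\<close> of the conformal dual.\<close>

definition dual_act :: "'k::field poly \<Rightarrow> ('q \<Rightarrow> 'k poly) \<Rightarrow> ('q \<Rightarrow> 'k poly)"
  where "dual_act p f = (\<lambda>u. pcompose p [:0, -1:] * f u)"

text \<open>
  \<open>dual_rep act \<phi> f\<close> is the polynomial \<open>P \<in> Q\<^sup>*\<^sup>c[\<lambda>]\<close> with
  \<open>\<langle>P, b\<rangle>\<^sub>\<mu> = - f\<^bsub>\<mu> - \<lambda>\<^esub>(\<phi>\<^sub>\<lambda> b)\<close> for all \<open>b\<close>; it exists if \<open>Q\<close> is finite
  (\<open>dual_rep_ex1\<close> below).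
\<close>

definition dual_rep ::
  "('k::field poly \<Rightarrow> 'q::ab_group_add \<Rightarrow> 'q) \<Rightarrow> ('q \<Rightarrow> 'q poly) \<Rightarrow> ('q \<Rightarrow> 'k poly) \<Rightarrow> ('q \<Rightarrow> 'k poly) poly"
  where "dual_rep act \<phi> f = (THE P. (\<forall>n. coeff P n \<in> cdual act) \<and>
    (\<forall>b. psubst (\<lambda>g. psubst const2 mul_mu (g b)) mul_lam P =
         - psubst (\<lambda>x. psubst const2 (\<lambda>p. mul_mu p - mul_lam p) (f x)) mul_lam (\<phi> b)))"

definition Lstar ::
  "('k::field poly \<Rightarrow> 'q::ab_group_add \<Rightarrow> 'q) \<Rightarrow> ('q \<Rightarrow> 'q \<Rightarrow> 'q poly) \<Rightarrow> 'q \<Rightarrow>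
    ('q \<Rightarrow> 'k poly) \<Rightarrow> ('q \<Rightarrow> 'k poly) poly"
  where "Lstar act br a f = dual_rep act (Lop br a) f"

definition Rstar ::
  "('k::field poly \<Rightarrow> 'q::ab_group_add \<Rightarrow> 'q) \<Rightarrow> ('q \<Rightarrow> 'q \<Rightarrow> 'q poly) \<Rightarrow> 'q \<Rightarrow>
    ('q \<Rightarrow> 'k poly) \<Rightarrow> ('q \<Rightarrow> 'k poly) poly"
  where "Rstar act br a f = dual_rep act (Rop act br a) f"

text \<open>\<open>\<sigma>(a \<otimes> b)\<^sub>\<lambda> g = \<langle>g, a\<rangle>\<^bsub>- \<lambda> - \<partial>\<^esub> b\<close>\<close>

definition sigma ::
  "('k::field poly \<Rightarrow> 'q::ab_group_add \<Rightarrow> 'q) \<Rightarrow> ('k, 'q) tens2 \<Rightarrow> ('q \<Rightarrow> 'k poly) \<Rightarrow> 'q poly"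
  where "sigma act r g =
    lift2 act (\<lambda>a b. psubst (\<lambda>c. const1 (smul act c b)) (neg_lam_der (der act)) (g a)) r"

definition sigma0 ::
  "('k::field poly \<Rightarrow> 'q::ab_group_add \<Rightarrow> 'q) \<Rightarrow> ('k, 'q) tens2 \<Rightarrow> ('q \<Rightarrow> 'k poly) \<Rightarrow> 'q"
  where "sigma0 act r g = coeff (sigma act r g) 0"


section \<open>Well-definedness\<close>

subsection \<open>Substitution\<close>

lemma additive_zero: "additive f \<Longrightarrow> f 0 = 0"
  by (rule additive.zero)

lemma additive_funpow: "additive (E :: 'a::ab_group_add \<Rightarrow> 'a) \<Longrightarrow> additive (E ^^ n)"
  by (induction n) (auto simp: additive_def)

lemma psubst_bound:
  assumes "i 0 = 0" "additive E" "degree p \<le> N"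
  shows "psubst i E p = (\<Sum>n\<le>N. (E ^^ n) (i (coeff p n)))"
  unfolding psubst_def
  by (rule sum.mono_neutral_left)
    (use assms in \<open>auto simp: coeff_eq_0 additive_zero[OF additive_funpow]\<close>)

lemma psubst_add:
  assumes "additive i" "additive E"
  shows "psubst i E (p + q) = psubst i E p + psubst i E q"
proof -
  let ?N = "max (degree p) (degree q)"
  have "degree (p + q) \<le> ?N" by (simp add: degree_add_le)
  then show ?thesis
    using assms
    by (simp add: psubst_bound[where N = ?N] additive_zero additive.add additive.add[OF additive_funpow]
        sum.distrib)
qed

lemma additive_psubst: "additive i \<Longrightarrow> additive E \<Longrightarrow> additive (psubst i E)"
  by (simp add: additive_def psubst_add)

lemma psubst_pCons:
  assumes "additive i" "additive E"
  shows "psubst i E (pCons a p) = i a + E (psubst i E p)"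
proof -
  have "degree (pCons a p) \<le> Suc (degree p)" by (rule degree_pCons_le)
  then have "psubst i E (pCons a p) = (\<Sum>n\<le>Suc (degree p). (E ^^ n) (i (coeff (pCons a p) n)))"
    using assms by (intro psubst_bound) (auto simp: additive_zero)
  also have "\<dots> = i a + (\<Sum>n\<le>degree p. E ((E ^^ n) (i (coeff p n))))"
    by (subst sum.atMost_Suc_shift) simp
  also have "\<dots> = i a + E (psubst i E p)"
    unfolding psubst_def by (simp add: additive.sum[OF assms(2)])
  finally show ?thesis .
qed

lemma psubst_0: "additive i \<Longrightarrow> additive E \<Longrightarrow> psubst i E 0 = 0"
  by (simp add: psubst_def additive_zero)

lemma psubst_map_poly:
  assumes "additive i" "additive E" "additive h"
  shows "psubst i E (map_poly h p) = psubst (\<lambda>x. i (h x)) E p"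
proof -
  have "additive (\<lambda>x. i (h x))" using assms by (simp add: additive_def)
  then show ?thesis
    by (induction p) (simp_all add: psubst_0 psubst_pCons map_poly_pCons assms additive_zero)
qed

lemma psubst_commute:
  assumes "additive i" "additive E" "additive D" "\<And>x. D (E x) = E (D x)"
  shows "psubst (\<lambda>x. D (i x)) E p = D (psubst i E p)"
proof -
  have "additive (\<lambda>x. D (i x))" using assms by (simp add: additive_def)
  then show ?thesis
    by (induction p) (simp_all add: psubst_0 psubst_pCons assms additive.add additive_zero)
qed

lemma additive_mul_lam: "additive mul_lam"
  by (simp add: additive_def mul_lam_def)

lemma additive_mul_mu: "additive mul_mu"
  by (auto simp: additive_def mul_mu_def coeff_map_poly intro!: poly_eqI)

lemmas additive_mul_simps = additive.add[OF additive_mul_lam] additive.add[OF additive_mul_mu]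

lemma additive_poly_ops:
  "additive mul_lam" "additive mul_mu" "additive const1" "additive const2"
  "additive (\<lambda>p. mul_mu p - mul_lam p)" "additive (\<lambda>p. - mul_lam p - mul_mu p)"
  "additive (\<lambda>p. mul_lam p + mul_mu p)"
  by (simp_all add: additive_mul_lam additive_mul_mu additive_def additive_mul_simps
      const1_def const2_def)

lemma additive_map_poly: "additive d \<Longrightarrow> additive (map_poly d)"
  by (auto simp: additive_def coeff_map_poly additive_zero intro!: poly_eqI)

lemma map_poly_const1: "h 0 = 0 \<Longrightarrow> map_poly h (const1 x) = const1 (h x)"
  by (simp add: const1_def map_poly_pCons)

lemma additive_lam_der: "additive d \<Longrightarrow> additive (lam_der d)"
  by (simp add: additive_def lam_der_def additive.add[OF additive_map_poly])

lemma additive_neg_lam_der: "additive d \<Longrightarrow> additive (neg_lam_der d)"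
  by (simp add: additive_def neg_lam_der_def additive.add[OF additive_map_poly])

lemma mul_lam_mul_mu: "mul_lam (mul_mu p) = mul_mu (mul_lam p)"
  by (simp add: mul_lam_def mul_mu_def map_poly_pCons)

lemma psubst_mul_mu: "psubst const2 mul_mu p = const1 p"
proof (induction p)
  case 0
  then show ?case by (simp add: psubst_0 additive_poly_ops const1_def)
next
  case (pCons a p)
  then show ?case
    by (simp add: psubst_pCons additive_poly_ops) (simp add: const1_def const2_def mul_mu_def map_poly_pCons)
qed

lemma psubst_mul_lam:
  assumes "additive h"
  shows "psubst (\<lambda>x. const1 (h x)) mul_lam P = map_poly h P"
proof -
  have a: "additive (\<lambda>x. const1 (h x))" using assms by (simp add: additive_def const1_def)
  show ?thesis
    by (induction P)
      (simp_all add: psubst_0 psubst_pCons a additive_poly_ops map_poly_pCons additive_zero[OF assms],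
        simp add: const1_def mul_lam_def)
qed


subsection \<open>Module structure\<close>

lemma vector_space_smul:
  assumes "module act"
  shows "vector_space (smul act)"
proof -
  interpret module act by fact
  show ?thesis
    by unfold_locales
      (simp_all add: smul_def scale_right_distrib scale_left_distrib[symmetric] mult.commute
        flip: one_pCons)
qed

lemma der_smul: "module act \<Longrightarrow> der act (smul act c a) = smul act c (der act a)"
  by (simp add: der_def smul_def module.scale_left_commute)

lemma additive_act: "module act \<Longrightarrow> additive (act p)"
  by (simp add: additive_def module.scale_right_distrib)

lemma additive_der: "module act \<Longrightarrow> additive (der act)"
  by (simp add: additive_def der_def module.scale_right_distrib)

lemma act_pCons:
  assumes "module act"
  shows "act (pCons c p) a = smul act c a + der act (act p a)"
proof -
  interpret module act by fact
  have "pCons c p = [:c:] + [:0, 1:] * p" by simp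
  then have "act (pCons c p) a = act ([:c:] + [:0, 1:] * p) a" by simp
  also have "\<dots> = smul act c a + der act (act p a)"
    by (simp only: scale_left_distrib smul_def der_def scale_scale)
  finally show ?thesis .
qed

lemma module_triv_act: "module triv_act"
  by unfold_locales (simp_all add: triv_act_def algebra_simps)

lemma module_dual_act: "module dual_act"
  by unfold_locales
    (simp_all add: dual_act_def fun_eq_iff algebra_simps pcompose_add pcompose_mult pcompose_1)

lemma der_dual_act: "der dual_act f = (\<lambda>u. - pCons 0 (f u))"
  by (simp add: der_def dual_act_def fun_eq_iff pcompose_pCons)

lemma smul_dual_act: "smul dual_act c f = (\<lambda>u. smult c (f u))"
  by (simp add: smul_def dual_act_def)

lemma smul_triv_act: "smul triv_act c = (*) c"
  by (simp add: smul_def triv_act_def fun_eq_iff)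

lemma lam_der_triv_act: "lam_der (der triv_act) p = pCons 0 p"
  by (rule poly_eqI) (simp add: lam_der_def der_def triv_act_def coeff_map_poly)

lemma cdual_iff:
  "f \<in> cdual act \<longleftrightarrow> (\<forall>u v. f (u + v) = f u + f v) \<and> (\<forall>c u. f (smul act c u) = smult c (f u)) \<and>
    (\<forall>u. f (der act u) = pCons 0 (f u))"
  by (simp add: cdual_def Chom_def lam_der_triv_act smul_triv_act smult_conv_map_poly)


subsection \<open>Universal property of the tensor products\<close>

lemma separating_functional:
  assumes "vector_space s" "u \<noteq> 0"
  obtains \<phi> where "Vector_Spaces.linear s (*) \<phi>" "\<phi> u = 1"
proof -
  have "vector_space ((*) :: 'a \<Rightarrow> 'a \<Rightarrow> 'a)"
    by unfold_locales (simp_all add: algebra_simps)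
  then interpret vector_space_pair s "(*)"
    using assms(1) by (simp add: vector_space_pair_def)
  have "vs1.independent {u}" using assms(2) by simp
  from linear_independent_extend[OF this, of "\<lambda>_. 1"] that show thesis by auto
qed

lemma linear_sum_list:
  "Vector_Spaces.linear s s' \<phi> \<Longrightarrow> \<phi> (sum_list (map f xs)) = (\<Sum>x\<leftarrow>xs. \<phi> (f x))"
  by (induction xs)
    (simp_all add: module_hom.add module_hom.zero Vector_Spaces.linear_iff_module_hom)

lemma sum_list_apply: "(sum_list (map f xs)) y = (\<Sum>x\<leftarrow>xs. f x y)"
  by (induction xs) simp_all

lemma bilinear_map_compose:
  "bilinear_map act s \<beta> \<Longrightarrow> Vector_Spaces.linear s s' \<phi> \<Longrightarrow> bilinear_map act s' (\<lambda>a b. \<phi> (\<beta> a b))"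
  unfolding bilinear_map_def using Vector_Spaces.linear_compose[unfolded comp_def] by blast

lemma trilinear_map_compose:
  "trilinear_map act s \<beta> \<Longrightarrow> Vector_Spaces.linear s s' \<phi> \<Longrightarrow>
    trilinear_map act s' (\<lambda>a b c. \<phi> (\<beta> a b c))"
  unfolding trilinear_map_def using Vector_Spaces.linear_compose[unfolded comp_def] by blast

lemma tsum2_eq_imp:
  assumes \<beta>: "bilinear_map act s \<beta>" and eq: "tsum2 act xs = tsum2 act ys"
  shows "(\<Sum>(a, b)\<leftarrow>xs. \<beta> a b) = (\<Sum>(a, b)\<leftarrow>ys. \<beta> a b)"
proof (rule ccontr)
  assume ne: "\<not> ?thesis"
  have "vector_space s" using \<beta> by (simp add: bilinear_map_def Vector_Spaces.linear_def)
  moreover have "(\<Sum>(a, b)\<leftarrow>xs. \<beta> a b) - (\<Sum>(a, b)\<leftarrow>ys. \<beta> a b) \<noteq> 0" using ne by simp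
  ultimately obtain \<phi> where \<phi>: "Vector_Spaces.linear s (*) \<phi>"
      "\<phi> ((\<Sum>(a, b)\<leftarrow>xs. \<beta> a b) - (\<Sum>(a, b)\<leftarrow>ys. \<beta> a b)) = 1"
    by (rule separating_functional)
  let ?B = "\<lambda>a b. \<phi> (\<beta> a b)"
  have B: "bilinear_map act (*) ?B" by (rule bilinear_map_compose[OF \<beta> \<phi>(1)])
  have *: "tsum2 act zs ?B = \<phi> (\<Sum>(a, b)\<leftarrow>zs. \<beta> a b)" for zs
    unfolding tsum2_def sum_list_apply linear_sum_list[OF \<phi>(1)]
    by (rule arg_cong[of _ _ sum_list]) (auto simp: tens2_def B)
  from \<phi> have "\<phi> (\<Sum>(a, b)\<leftarrow>xs. \<beta> a b) - \<phi> (\<Sum>(a, b)\<leftarrow>ys. \<beta> a b) = 1"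
    by (simp add: module_hom.diff Vector_Spaces.linear_iff_module_hom)
  then show False using *[of xs] *[of ys] eq by simp
qed

lemma tsum3_eq_imp:
  assumes \<beta>: "trilinear_map act s \<beta>" and eq: "tsum3 act xs = tsum3 act ys"
  shows "(\<Sum>(a, b, c)\<leftarrow>xs. \<beta> a b c) = (\<Sum>(a, b, c)\<leftarrow>ys. \<beta> a b c)"
proof (rule ccontr)
  assume ne: "\<not> ?thesis"
  have "vector_space s" using \<beta> by (simp add: trilinear_map_def Vector_Spaces.linear_def)
  moreover have "(\<Sum>(a, b, c)\<leftarrow>xs. \<beta> a b c) - (\<Sum>(a, b, c)\<leftarrow>ys. \<beta> a b c) \<noteq> 0" using ne by simp
  ultimately obtain \<phi> where \<phi>: "Vector_Spaces.linear s (*) \<phi>"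
      "\<phi> ((\<Sum>(a, b, c)\<leftarrow>xs. \<beta> a b c) - (\<Sum>(a, b, c)\<leftarrow>ys. \<beta> a b c)) = 1"
    by (rule separating_functional)
  let ?B = "\<lambda>a b c. \<phi> (\<beta> a b c)"
  have B: "trilinear_map act (*) ?B" by (rule trilinear_map_compose[OF \<beta> \<phi>(1)])
  have *: "tsum3 act zs ?B = \<phi> (\<Sum>(a, b, c)\<leftarrow>zs. \<beta> a b c)" for zs
    unfolding tsum3_def sum_list_apply linear_sum_list[OF \<phi>(1)]
    by (rule arg_cong[of _ _ sum_list]) (auto simp: tens3_def B)
  from \<phi> have "\<phi> (\<Sum>(a, b, c)\<leftarrow>xs. \<beta> a b c) - \<phi> (\<Sum>(a, b, c)\<leftarrow>ys. \<beta> a b c) = 1"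
    by (simp add: module_hom.diff Vector_Spaces.linear_iff_module_hom)
  then show False using *[of xs] *[of ys] eq by simp
qed

lemma lift2_tsum2:
  assumes "bilinear_map act s \<beta>"
  shows "lift2 act \<beta> (tsum2 act xs) = (\<Sum>(a, b)\<leftarrow>xs. \<beta> a b)"
  unfolding lift2_def
  by (rule tsum2_eq_imp[OF assms]) (rule someI[of _ xs], rule refl)

lemma lift3_tsum3:
  assumes "trilinear_map act s \<beta>"
  shows "lift3 act \<beta> (tsum3 act xs) = (\<Sum>(a, b, c)\<leftarrow>xs. \<beta> a b c)"
  unfolding lift3_def
  by (rule tsum3_eq_imp[OF assms]) (rule someI[of _ xs], rule refl)

lemma bilinear_map_tens2:
  fixes act :: "'k::field poly \<Rightarrow> 'q::ab_group_add \<Rightarrow> 'q"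
  assumes "module act"
  shows "bilinear_map act (\<lambda>c t B. c * t B) (tens2 act)"
proof -
  have "vector_space (smul act)" by (rule vector_space_smul[OF assms])
  moreover have "vector_space (\<lambda>c (t :: ('k, 'q) tens2) B. c * t B)"
    by unfold_locales (simp_all add: fun_eq_iff algebra_simps)
  ultimately show ?thesis
    by (auto simp: bilinear_map_def Vector_Spaces.linear_iff tens2_def fun_eq_iff)
qed

lemma trilinear_map_tens3:
  fixes act :: "'k::field poly \<Rightarrow> 'q::ab_group_add \<Rightarrow> 'q"
  assumes "module act"
  shows "trilinear_map act (\<lambda>c t B. c * t B) (tens3 act)"
proof -
  have "vector_space (smul act)" by (rule vector_space_smul[OF assms])
  moreover have "vector_space (\<lambda>c (t :: ('k, 'q) tens3) B. c * t B)"
    by unfold_locales (simp_all add: fun_eq_iff algebra_simps)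
  ultimately show ?thesis
    by (auto simp: trilinear_map_def Vector_Spaces.linear_iff tens3_def fun_eq_iff)
qed


lemma tau_tsum2: "module act \<Longrightarrow> tau act (tsum2 act xs) = (\<Sum>(a, b)\<leftarrow>xs. tens2 act b a)"
  unfolding tau_def
  by (rule lift2_tsum2[where s = "\<lambda>c t B. c * t B"])
    (use bilinear_map_tens2 in \<open>auto simp: bilinear_map_def\<close>)

lemma linear_der: "module act \<Longrightarrow> Vector_Spaces.linear (smul act) (smul act) (der act)"
  by (simp add: Vector_Spaces.linear_iff vector_space_smul der_smul additive.add[OF additive_der])

lemma
  assumes "module act"
  shows der3_1_tsum3: "der3_1 act (tsum3 act xs) = (\<Sum>(a, b, c)\<leftarrow>xs. tens3 act (der act a) b c)"
    and der3_2_tsum3: "der3_2 act (tsum3 act xs) = (\<Sum>(a, b, c)\<leftarrow>xs. tens3 act a (der act b) c)"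
    and der3_3_tsum3: "der3_3 act (tsum3 act xs) = (\<Sum>(a, b, c)\<leftarrow>xs. tens3 act a b (der act c))"
  unfolding der3_1_def der3_2_def der3_3_def
  by (rule lift3_tsum3[where s = "\<lambda>c t B. c * t B"];
      use trilinear_map_tens3[OF assms] Vector_Spaces.linear_compose[OF linear_der[OF assms], unfolded comp_def]
      in \<open>fastforce simp: trilinear_map_def\<close>)+

lemma der2_tsum2:
  fixes act :: "'k::field poly \<Rightarrow> 'q::ab_group_add \<Rightarrow> 'q"
  assumes "module act"
  shows "der2 act (tsum2 act xs) =
    (\<Sum>(a, b)\<leftarrow>xs. tens2 act (der act a) b + tens2 act a (der act b))"
  unfolding der2_def
  by (rule lift2_tsum2[where s = "\<lambda>c t B. c * t B"])
    (use bilinear_map_tens2[OF assms] in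
      \<open>auto simp: bilinear_map_def Vector_Spaces.linear_iff der_smul[OF assms]
        additive.add[OF additive_der[OF assms]] fun_eq_iff algebra_simps\<close>)


subsection \<open>The dual representations and \<open>\<sigma>\<close>\<close>

lemma dual_rep_ex1:
  assumes fg: "fg_module act" and \<phi>: "\<phi> \<in> Chom UNIV act act" and f: "f \<in> cdual act"
  shows "\<exists>!P. (\<forall>n. coeff P n \<in> cdual act) \<and>
    (\<forall>b. psubst (\<lambda>g. psubst const2 mul_mu (g b)) mul_lam P =
         - psubst (\<lambda>x. psubst const2 (\<lambda>p. mul_mu p - mul_lam p) (f x)) mul_lam (\<phi> b))"
proof -
  have m: "module act" using fg by (simp add: fg_module_def)
  define D where "D = (\<lambda>p :: 'a poly poly. mul_mu p - mul_lam p)"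
  define i where "i = (\<lambda>x. psubst const2 D (f x))"
  define G where "G = (\<lambda>b. - psubst i mul_lam (\<phi> b))"
  have D: "additive D" unfolding D_def by (rule additive_poly_ops)
  have fa: "additive f" using f by (simp add: cdual_iff additive_def)
  have i: "additive i"
    unfolding i_def additive_def
    by (simp add: additive.add[OF fa] psubst_add additive_poly_ops D)
  have \<phi>a: "\<phi> (a + b) = \<phi> a + \<phi> b" "\<phi> (smul act c a) = map_poly (smul act c) (\<phi> a)"
    "\<phi> (der act a) = lam_der (der act) (\<phi> a)" for a b c
    using \<phi> by (auto simp: Chom_def)
  have G_add: "G (a + b) = G a + G b" for a b
    by (simp add: G_def \<phi>a psubst_add i additive_poly_ops)
  have G_0: "G 0 = 0" using G_add[of 0 0] by (metis add_cancel_left_left add_0)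
  have sm: "additive (smult c :: 'a poly poly \<Rightarrow> _)" "additive (smult c' :: 'a poly \<Rightarrow> _)" for c c'
    by (simp_all add: additive_def smult_add_right)
  have i_smul: "i (smul act c x) = smult [:c:] (i x)" for c x
  proof -
    have "D (smult [:c:] p) = smult [:c:] (D p)" for p
      by (auto simp: D_def mul_mu_def mul_lam_def coeff_map_poly smult_diff_right intro!: poly_eqI)
    then have "psubst const2 D (smult c p) = smult [:c:] (psubst const2 D p)" for p
      by (induction p)
        (simp_all add: psubst_0 psubst_pCons additive_poly_ops D smult_add_right, simp add: const2_def)
    then show ?thesis using f by (simp add: i_def cdual_iff)
  qed
  have i_der: "i (der act x) = D (i x)" for x
    using f by (simp add: i_def cdual_iff psubst_pCons additive_poly_ops D) (simp add: const2_def)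
  have G_smul: "G (smul act c b) = smult [:c:] (G b)" for c b
  proof -
    have "additive (smul act c)" using m by (simp add: additive_def smul_def module.scale_right_distrib)
    then have "psubst i mul_lam (map_poly (smul act c) p) = smult [:c:] (psubst i mul_lam p)" for p
      using psubst_commute[OF i _ sm(1), of mul_lam "[:c:]" p]
      by (simp add: psubst_map_poly i additive_poly_ops i_smul mul_lam_def)
    then show ?thesis by (simp add: G_def \<phi>a)
  qed
  have G_der: "G (der act b) = mul_mu (G b)" for b
  proof -
    have "D (mul_lam x) = mul_lam (D x)" for x
      by (simp add: D_def mul_lam_mul_mu additive.diff[OF additive_poly_ops(1)])
    then have "psubst i mul_lam (map_poly (der act) p) = D (psubst i mul_lam p)" for p
      using psubst_commute[OF i additive_poly_ops(1) D, of p]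
      by (simp add: psubst_map_poly i additive_poly_ops i_der additive_der[OF m])
    then show ?thesis
      by (simp add: G_def \<phi>a lam_der_def psubst_add i additive_poly_ops psubst_pCons additive_zero[OF i]
          additive.minus[OF additive_poly_ops(2)])
        (simp add: D_def)
  qed
  have degree_mul_mu: "degree (mul_mu p) = degree p" for p :: "'a poly poly"
    unfolding mul_mu_def by (rule degree_map_poly) simp
  obtain S where S: "finite S" "module.span act S = UNIV" using fg by (auto simp: fg_module_def)
  define N where "N = Max (insert 0 ((\<lambda>b. degree (G b)) ` S))"
  let ?V = "{b. degree (G b) \<le> N}"
  have act_G: "degree (G (act p b)) \<le> degree (G b)" for p b
  proof (induction p)
    case 0
    show ?case by (simp add: module.scale_zero_left[OF m] G_0)
  next
    case (pCons c p)
    then show ?case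
      by (auto simp: act_pCons[OF m] G_add G_smul G_der degree_mul_mu intro!: degree_add_le
          order_trans[OF degree_smult_le])
  qed
  have "module.subspace act ?V"
    unfolding module.subspace_def[OF m]
  proof (intro conjI ballI allI)
    show "act c x \<in> ?V" if "x \<in> ?V" for c x
      using act_G[of c x] that by simp
  qed (simp_all add: G_0 G_add degree_add_le)
  moreover have "S \<subseteq> ?V" using S(1) by (auto simp: N_def)
  ultimately have "module.span act S \<subseteq> ?V" by (metis module.span_minimal[OF m])
  then have N: "degree (G b) \<le> N" for b using S(2) by auto
  define P where "P = (\<Sum>n\<le>N. monom (\<lambda>b. coeff (G b) n) n)"
  have P: "coeff P n = (\<lambda>b. coeff (G b) n)" for n
  proof -
    have "coeff P n = (if n \<le> N then (\<lambda>b. coeff (G b) n) else 0)"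
      by (simp add: P_def coeff_sum)
    moreover have "coeff (G b) n = 0" if "\<not> n \<le> N" for b
      using N[of b] that by (simp add: coeff_eq_0)
    ultimately show ?thesis by (simp add: fun_eq_iff)
  qed
  have eq: "psubst (\<lambda>g. psubst const2 mul_mu (g b)) mul_lam P' = map_poly (\<lambda>g. g b) P'"
    for P' :: "('b \<Rightarrow> 'a poly) poly" and b
    unfolding psubst_mul_mu by (rule psubst_mul_lam) (simp add: additive_def)
  have P_cdual: "coeff P n \<in> cdual act" for n
    by (auto simp: cdual_iff P G_add G_smul G_der mul_mu_def coeff_map_poly)
  define C where "C = (\<lambda>P'. \<forall>b. psubst (\<lambda>g. psubst const2 mul_mu (g b)) mul_lam P' =
         - psubst (\<lambda>x. psubst const2 (\<lambda>p. mul_mu p - mul_lam p) (f x)) mul_lam (\<phi> b))"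
  have C: "C P' \<longleftrightarrow> P' = P" for P'
  proof -
    have "C P' \<longleftrightarrow> (\<forall>b. map_poly (\<lambda>g. g b) P' = G b)"
      by (simp only: C_def eq G_def i_def D_def)
    also have "\<dots> \<longleftrightarrow> (\<forall>n b. coeff P' n b = coeff P n b)"
      unfolding P by (subst poly_eq_iff) (auto simp: coeff_map_poly)
    also have "\<dots> \<longleftrightarrow> P' = P"
      by (auto intro: poly_eqI)
    finally show ?thesis .
  qed
  have "\<exists>!P'. (\<forall>n. coeff P' n \<in> cdual act) \<and> C P'"
    unfolding C by (rule ex1I[of _ P]) (use P_cdual in blast)+
  then show ?thesis unfolding C_def .
qed

lemma (in leibniz_conformal_algebra) Lop_Chom: "Lop br a \<in> Chom UNIV act act"
proof -
  have "Vector_Spaces.linear (smul act) (\<lambda>c. map_poly (smul act c)) (br a)"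
    using br_bilinear by (simp add: bilinear_map_def)
  then show ?thesis by (simp add: Chom_def Lop_def Vector_Spaces.linear_iff br_der_right)
qed

lemma map_poly_smul_neg_lam_der:
  assumes "module act"
  shows "map_poly (smul act c) (neg_lam_der (der act) p) =
    neg_lam_der (der act) (map_poly (smul act c) p)"
proof -
  have a: "additive (smul act c)" using assms by (simp add: additive_def smul_def module.scale_right_distrib)
  show ?thesis
    by (rule poly_eqI)
      (simp add: neg_lam_der_def coeff_map_poly additive_zero[OF a] additive_zero[OF additive_der[OF assms]]
        additive.minus[OF a] additive.diff[OF a] der_smul[OF assms] coeff_pCons split: nat.split)
qed

lemma (in leibniz_conformal_algebra) Rop_Chom: "Rop act br a \<in> Chom UNIV act act"
proof -
  have m: "module act" by unfold_locales
  note [simp] = additive_poly_ops(3) additive_neg_lam_der[OF additive_der[OF m]]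
  have ad: "additive (smul act c)" "additive (\<lambda>x. const1 (smul act c x))" for c
    by (simp_all add: additive_def smul_def scale_right_distrib const1_def)
  have "psubst const1 (neg_lam_der (der act)) (map_poly (smul act c) p) =
      map_poly (smul act c) (psubst const1 (neg_lam_der (der act)) p)" for c p
    using psubst_commute[of const1 "neg_lam_der (der act)" "map_poly (smul act c)" p]
    by (simp add: psubst_map_poly ad additive_map_poly map_poly_smul_neg_lam_der[OF m])
      (simp add: const1_def map_poly_pCons additive_zero[OF ad(1)])
  moreover have "psubst const1 (neg_lam_der (der act)) (- pCons 0 p) =
      lam_der (der act) (psubst const1 (neg_lam_der (der act)) p)" for p
    by (simp add: additive.minus[OF additive_psubst] psubst_pCons)
      (simp add: const1_def neg_lam_der_def lam_der_def additive.minus[OF additive_map_poly[OF additive_der[OF m]]])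
  moreover have "Vector_Spaces.linear (smul act) (\<lambda>c. map_poly (smul act c)) (\<lambda>b. br b a)"
    using br_bilinear by (simp add: bilinear_map_def)
  ultimately show ?thesis
    by (simp add: Chom_def Rop_def Vector_Spaces.linear_iff psubst_add br_der_left)
qed

lemma vector_space_map_poly:
  assumes "vector_space s"
  shows "vector_space (\<lambda>c. map_poly (s c))"
proof -
  interpret vector_space s by fact
  show ?thesis
    by unfold_locales
      (auto intro!: poly_eqI simp: coeff_map_poly scale_right_distrib scale_left_distrib)
qed

lemma sigma_bilinear:
  assumes m: "module act" and g: "g \<in> cdual act"
  shows "bilinear_map act (\<lambda>c. map_poly (smul act c))
    (\<lambda>a b. psubst (\<lambda>c. const1 (smul act c b)) (neg_lam_der (der act)) (g a))"
proof -
  interpret vs: vector_space "smul act" by (rule vector_space_smul[OF m])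
  let ?E = "neg_lam_der (der act)"
  note [simp] = additive_neg_lam_der[OF additive_der[OF m]]
  have i [simp]: "additive (\<lambda>c. const1 (smul act c b))" for b
    by (simp add: additive_def const1_def vs.scale_left_distrib)
  have E0 [simp]: "?E 0 = 0" by (simp add: neg_lam_der_def)
  have 1: "psubst (\<lambda>c. const1 (smul act c b)) ?E (smult k p) =
      map_poly (smul act k) (psubst (\<lambda>c. const1 (smul act c b)) ?E p)" for k b p
  proof -
    have "additive (\<lambda>p. map_poly (smul act k) p)"
      by (rule additive_map_poly) (simp add: additive_def vs.scale_right_distrib)
    then show ?thesis
      by (induction p)
        (simp_all add: psubst_0 psubst_pCons additive.add map_poly_smul_neg_lam_der[OF m]
          map_poly_const1)
  qed
  have 2: "psubst (\<lambda>c. const1 (smul act c (a + b))) ?E p =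
      psubst (\<lambda>c. const1 (smul act c a)) ?E p + psubst (\<lambda>c. const1 (smul act c b)) ?E p" for a b p
  proof (induction p)
    case 0
    show ?case by (simp only: psubst_0 i additive_neg_lam_der[OF additive_der[OF m]]) simp
  next
    case (pCons c p)
    have "const1 (smul act c (a + b)) = const1 (smul act c a) + const1 (smul act c b)"
      by (simp add: const1_def vs.scale_right_distrib)
    with pCons show ?case
      by (simp only: psubst_pCons i additive_neg_lam_der[OF additive_der[OF m]]
          additive.add[OF additive_neg_lam_der[OF additive_der[OF m]]]) (simp add: algebra_simps)
  qed
  have 3: "psubst (\<lambda>c. const1 (smul act c (smul act k b))) ?E p =
      map_poly (smul act k) (psubst (\<lambda>c. const1 (smul act c b)) ?E p)" for k b p
  proof -
    have "additive (\<lambda>p. map_poly (smul act k) p)"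
      by (rule additive_map_poly) (simp add: additive_def vs.scale_right_distrib)
    moreover have "additive (\<lambda>c. const1 (smul act (c * k) b))"
      by (simp add: additive_def const1_def distrib_right vs.scale_left_distrib)
    ultimately show ?thesis
      by (induction p)
        (simp_all add: psubst_0 psubst_pCons additive.add map_poly_smul_neg_lam_der[OF m]
          map_poly_const1 mult.commute)
  qed
  show ?thesis
    using g by (simp add: bilinear_map_def Vector_Spaces.linear_iff vs.vector_space_axioms
        vector_space_map_poly cdual_iff psubst_add 1 2 3[unfolded vs.scale_scale])
qed

lemma sigma_tsum2:
  assumes "module act" "g \<in> cdual act"
  shows "sigma act (tsum2 act xs) g =
    (\<Sum>(a, b)\<leftarrow>xs. psubst (\<lambda>c. const1 (smul act c b)) (neg_lam_der (der act)) (g a))"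
  unfolding sigma_def by (rule lift2_tsum2[OF sigma_bilinear[OF assms]])

lemma cdual_closed:
  assumes "module act" "f \<in> cdual act"
  shows "g \<in> cdual act \<Longrightarrow> f + g \<in> cdual act" "smul dual_act c f \<in> cdual act"
    "der dual_act f \<in> cdual act"
  using assms by (simp_all add: cdual_iff smul_dual_act der_dual_act smult_add_right mult.commute)

lemma sigma_Chom:
  assumes m: "module act" and r: "r \<in> tensor2 act"
  shows "sigma act r \<in> Chom (cdual act) dual_act act"
proof -
  interpret vs: vector_space "smul act" by (rule vector_space_smul[OF m])
  let ?E = "neg_lam_der (der act)"
  let ?s = "\<lambda>(a, b) g. psubst (\<lambda>c. const1 (smul act c b)) ?E (g a)"
  obtain xs where xs: "r = tsum2 act xs" using r by (auto simp: tensor2_def)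
  note cl = cdual_closed[OF m]
  note [simp] = additive_neg_lam_der[OF additive_der[OF m]]
  have i [simp]: "additive (\<lambda>c. const1 (smul act c b))" for b
    by (simp add: additive_def const1_def vs.scale_left_distrib)
  have ak: "additive (\<lambda>p. map_poly (smul act k) p)" for k
    by (rule additive_map_poly) (simp add: additive_def vs.scale_right_distrib)
  have s: "sigma act r g = (\<Sum>x\<leftarrow>xs. ?s x g)" if "g \<in> cdual act" for g
    using sigma_tsum2[OF m that] by (simp add: xs split_def)
  have 1: "?s x (f + g) = ?s x f + ?s x g" for x f g
    by (simp add: split_def psubst_add)
  have 2: "?s x (smul dual_act k g) = map_poly (smul act k) (?s x g)" for x g k
  proof -
    have "psubst (\<lambda>c. const1 (smul act c b)) ?E (smult k p) =
      map_poly (smul act k) (psubst (\<lambda>c. const1 (smul act c b)) ?E p)" for b p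
      using ak by (induction p)
        (simp_all add: psubst_0 psubst_pCons additive.add map_poly_smul_neg_lam_der[OF m]
          map_poly_const1)
    then show ?thesis by (simp add: split_def smul_dual_act)
  qed
  have 3: "?s x (der dual_act g) = lam_der (der act) (?s x g)" for x g
    by (simp add: split_def der_dual_act additive.minus[OF additive_psubst] psubst_pCons)
      (simp add: const1_def neg_lam_der_def lam_der_def additive.minus[OF additive_map_poly[OF additive_der[OF m]]])
  have sl: "h (\<Sum>x\<leftarrow>xs. ?s x g) = (\<Sum>x\<leftarrow>xs. h (?s x g))" if "additive h" for h :: "'b poly \<Rightarrow> 'b poly" and g
    by (induction xs) (simp_all add: additive_zero[OF that] additive.add[OF that])
  show ?thesis
    unfolding Chom_def
    by (auto simp: s cl 1 2 3 sum_list_addf sl[OF ak] sl[OF additive_lam_der[OF additive_der[OF m]]]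
        simp del: split_paired_All)
qed

text \<open>\<open>\<langle>f, \<sigma>(a \<otimes> b)\<^sub>\<lambda> g\<rangle>\<^sub>\<mu> = \<langle>g \<otimes> f, a \<otimes> b\<rangle>\<^bsub>- \<lambda> - \<mu>, \<mu>\<^esub>\<close>\<close>

lemma sigma_pairing:
  assumes m: "module act" and f: "f \<in> cdual act" and g: "g \<in> cdual act"
  shows "psubst (\<lambda>x. psubst const2 mul_mu (f x)) mul_lam (sigma act (tens2 act a b) g) =
    psubst const2 (\<lambda>p. - mul_lam p - mul_mu p) (g a) * psubst const2 mul_mu (f b)"
proof -
  interpret vs: vector_space "smul act" by (rule vector_space_smul[OF m])
  let ?E = "neg_lam_der (der act)"
  note [simp] = additive_neg_lam_der[OF additive_der[OF m]]
  have i [simp]: "additive (\<lambda>c. const1 (smul act c b))" for b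
    by (simp add: additive_def const1_def vs.scale_left_distrib)
  have fa: "additive (\<lambda>x. const1 (f x))" "additive f" using f by (simp_all add: additive_def cdual_iff const1_def)
  have "sigma act (tens2 act a b) g = psubst (\<lambda>c. const1 (smul act c b)) ?E (g a)"
    using sigma_tsum2[OF m g, of "[(a, b)]"] by (simp add: tsum2_def)
  moreover have "map_poly f (psubst (\<lambda>c. const1 (smul act c b)) ?E p) =
      psubst const2 (\<lambda>p. - mul_lam p - mul_mu p) p * const1 (f b)" for p
  proof (induction p)
    case 0
    then show ?case by (simp add: psubst_0 additive_poly_ops)
  next
    case (pCons c p)
    have n: "map_poly f (?E q) = - mul_lam (map_poly f q) - mul_mu (map_poly f q)" for q
      using f
      by (intro poly_eqI)
        (simp add: neg_lam_der_def mul_lam_def mul_mu_def coeff_map_poly additive_zero[OF fa(2)]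
          additive.diff[OF fa(2)] additive.minus[OF fa(2)] additive_zero[OF additive_der[OF m]]
          cdual_iff coeff_pCons split: nat.split)
    have mu: "mul_mu q = smult [:0, 1:] q" for q :: "'a poly poly"
      by (rule poly_eqI) (simp add: mul_mu_def coeff_map_poly)
    have c: "const1 (smult c (f b)) = const2 c * const1 (f b)" by (simp add: const1_def const2_def)
    have fs: "f (smul act c b) = smult c (f b)" using f by (simp add: cdual_iff)
    have lam: "mul_lam q = [:0, 1:] * q" for q :: "'a poly poly" by (simp add: mul_lam_def)
    from pCons show ?case
      by (simp add: psubst_pCons additive_poly_ops additive.add[OF additive_map_poly[OF fa(2)]] n
          map_poly_const1 additive_zero[OF fa(2)] fs c)
        (simp only: lam mu algebra_simps mult_smult_left mult_smult_right mult_minus_left mult_minus_right)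
  qed
  ultimately show ?thesis
    by (simp only: psubst_mul_mu psubst_mul_lam[OF fa(2)])
qed

end

theory Submission
  imports Defs
begin

text \<open>
  Write \<open>\<nu> = - \<lambda> - \<partial>\<close>. The commutative ring \<open>k[\<lambda>, \<partial>]\<close> acts on \<open>Q[\<lambda>]\<close>, and a functional
  \<open>x \<in> Q\<^sup>*\<^sup>c\<close> can be evaluated with any ring element in place of its variable. For two
  functionals \<open>x, y\<close> consider the map \<open>Q \<otimes> Q \<otimes> Q \<rightarrow> Q[\<lambda>]\<close>, \<open>u \<otimes> v \<otimes> w \<mapsto> x\<^sub>\<lambda>(v) y\<^sub>\<nu>(w) u\<close>
  (\<open>pair3\<close>). It turns \<open>\<partial>\<^sub>1, \<partial>\<^sub>2, \<partial>\<^sub>3\<close> into \<open>\<partial>, \<lambda>, \<nu>\<close>; since \<open>\<partial> + \<lambda> + \<nu> = 0\<close>, it kills every total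
  derivative. If \<open>Q\<close> is free of finite rank, a tensor that is killed for all \<open>x, y\<close> is a total
  derivative: modulo total derivatives \<open>\<partial>\<^sub>3 = - \<partial>\<^sub>1 - \<partial>\<^sub>2\<close>, so the tensor is determined by its
  coordinates with respect to a basis in the last two factors, and the functionals of the dual basis
  recover these coordinates (\<open>image_der3_iff\<close>). Hence \<open>r\<close> is a solution exactly if an explicit
  polynomial, the pairing of \<open>[[r, r]]\<close> with \<open>x, y\<close>, vanishes for all \<open>x, y\<close>
  (\<open>clcybe_solution_iff\<close>).

  The other side is a computation with the definition of \<open>L\<^sup>*\<close> and \<open>R\<^sup>*\<close>: for
  \<open>t = \<Sum>\<^sub>i u\<^sub>i \<otimes> v\<^sub>i\<close>, the two sides of the equation for \<open>\<sigma>(t)\<close> differ by an explicit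
  polynomial \<open>defect\<close> (\<open>equation_defect\<close>). For \<open>t = \<tau> r\<close> the defect equals the pairing of
  \<open>[[r, r]]\<close> term by term, which is the first equivalence.

  For the second equivalence, let \<open>s = r - \<tau> r\<close> be invariant. Pairing the first factor of
  \<open>F(c) s = 0\<close> with \<open>x\<^sub>\<lambda>\<close> gives one identity (\<open>invariant_pair_first\<close>). As \<open>s\<close> is antisymmetric,
  \<open>F(c) s - \<tau> (F(c) s) = (L(c) \<otimes> id + id \<otimes> L(c)) s\<close>, and pairing this with \<open>y\<^sub>\<nu>\<close> in the second
  factor gives another one (\<open>invariant_pair_second\<close>). With \<open>c = a\<^sub>i\<close> in the first and \<open>c = b\<^sub>i\<close> in
  the second, the two identities show that the defects for \<open>t = \<tau> r\<close> and \<open>t = r\<close> are equal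
  (\<open>defect_tau_eq\<close>).
\<close>

section \<open>Substitution into polynomials with module coefficients\<close>

lemma additive_times: "additive ((*) (e :: 'r::comm_ring_1))"
  by (simp add: additive_def algebra_simps)

lemma additive_shift: "additive (pCons (0 :: 'v::ab_group_add))"
  by (simp add: additive_def)

text \<open>
  Tensors, \<open>k[\<lambda>, \<partial>]\<close> and \<open>Q[\<lambda>]\<close> are compared throughout by moving a map through a substitution.
  The version relative to a set \<open>S\<close> serves operators such as \<open>der3_1\<close>, which are additive only on
  the tensors inside the ambient function type.
\<close>

lemma psubst_transport:
  assumes i: "additive i" and E: "additive E" and E': "additive E'" and h: "additive h"
    and hE: "\<And>t. h (E t) = E' (h t)"
  shows "h (psubst i E p) = psubst (\<lambda>z. h (i z)) E' p"
proof -
  have hi: "additive (\<lambda>z. h (i z))" using i h by (simp add: additive_def)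
  show ?thesis
    by (induction p)
      (simp_all add: psubst_0 psubst_pCons i E E' hi additive.add[OF h] additive_zero[OF h] hE)
qed

lemma psubst_transport_on:
  assumes S0: "0 \<in> S" "\<And>s t. s \<in> S \<Longrightarrow> t \<in> S \<Longrightarrow> s + t \<in> S" "\<And>t. t \<in> S \<Longrightarrow> E t \<in> S"
    and i: "\<And>n. i (coeff p n) \<in> S"
    and h: "\<And>s t. s \<in> S \<Longrightarrow> t \<in> S \<Longrightarrow> h (s + t) = h s + h t" "h 0 = 0"
    and hE: "\<And>t. t \<in> S \<Longrightarrow> h (E t) = E' (h t)"
  shows "psubst i E p \<in> S" "h (psubst i E p) = psubst (\<lambda>z. h (i z)) E' p"
proof -
  have *: "(E ^^ n) t \<in> S \<and> h ((E ^^ n) t) = (E' ^^ n) (h t)" if "t \<in> S" for n t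
    by (induction n) (use that S0 hE in auto)
  have "(\<Sum>n\<in>N. (E ^^ n) (i (coeff p n))) \<in> S \<and>
      h (\<Sum>n\<in>N. (E ^^ n) (i (coeff p n))) = (\<Sum>n\<in>N. (E' ^^ n) (h (i (coeff p n))))"
    if "finite N" for N
    using that by (induction N) (use * i S0 h in auto)
  then show "psubst i E p \<in> S" "h (psubst i E p) = psubst (\<lambda>z. h (i z)) E' p"
    unfolding psubst_def by simp_all
qed

lemma psubst_cong_on:
  assumes "0 \<in> S" "\<And>s t. s \<in> S \<Longrightarrow> t \<in> S \<Longrightarrow> s + t \<in> S" "\<And>t. t \<in> S \<Longrightarrow> E t \<in> S"
    and "\<And>z. i z \<in> S" and "\<And>t. t \<in> S \<Longrightarrow> E t = E' t"
  shows "psubst i E p = psubst i E' p"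
  using psubst_transport_on(2)[of S E i p "\<lambda>t. t" E'] assms by simp

lemma linear_sumI:
  assumes "vector_space s" "vector_space s'" "\<And>j. j \<in> J \<Longrightarrow> Vector_Spaces.linear s s' (f j)"
  shows "Vector_Spaces.linear s s' (\<lambda>b. \<Sum>j\<in>J. f j b)"
proof -
  interpret V: vector_space s' by fact
  show ?thesis
    using assms by (auto simp: Vector_Spaces.linear_iff sum.distrib V.scale_sum_right)
qed

lemma linear_addI:
  assumes "Vector_Spaces.linear s s' f" "Vector_Spaces.linear s s' g"
  shows "Vector_Spaces.linear s s' (\<lambda>b. f b + g b)" "Vector_Spaces.linear s s' (\<lambda>b. f b - g b)"
proof -
  interpret V: vector_space s' using assms by (simp add: Vector_Spaces.linear_iff)
  show "Vector_Spaces.linear s s' (\<lambda>b. f b + g b)" "Vector_Spaces.linear s s' (\<lambda>b. f b - g b)"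
    using assms by (auto simp: Vector_Spaces.linear_iff V.scale_right_distrib V.scale_right_diff_distrib)
qed

lemma linear_uminusI:
  assumes "Vector_Spaces.linear s s' f"
  shows "Vector_Spaces.linear s s' (\<lambda>b. - f b)"
proof -
  interpret V: vector_space s' using assms by (simp add: Vector_Spaces.linear_iff)
  show ?thesis using assms by (auto simp: Vector_Spaces.linear_iff)
qed

lemma linear_comp:
  "Vector_Spaces.linear s' s'' g \<Longrightarrow> Vector_Spaces.linear s s' f \<Longrightarrow> Vector_Spaces.linear s s'' (\<lambda>b. g (f b))"
  using Vector_Spaces.linear_compose[unfolded comp_def] .

lemma linear_additive: "Vector_Spaces.linear s s' f \<Longrightarrow> additive f"
  by (simp add: Vector_Spaces.linear_iff additive_def)

lemma linear_funpow:
  assumes "Vector_Spaces.linear s s E"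
  shows "Vector_Spaces.linear s s (E ^^ n)"
proof (induction n)
  case 0
  show ?case using assms by (simp add: Vector_Spaces.linear_iff)
next
  case (Suc n)
  then show ?case using linear_comp[OF assms] by simp
qed

text \<open>
  The expressions that are lifted to \<open>Q \<otimes> Q\<close> are bilinear because a substitution is linear in the
  polynomial and, by the next lemma, in every parameter on which the embedding of the coefficients
  depends linearly.
\<close>

lemma linear_psubst:
  assumes i: "Vector_Spaces.linear s s' i" and E: "Vector_Spaces.linear s' s' E"
  shows "Vector_Spaces.linear (\<lambda>c. map_poly (s c)) s' (psubst i E)"
proof -
  interpret V: vector_space s using i by (simp add: Vector_Spaces.linear_iff)
  interpret V': vector_space s' using i by (simp add: Vector_Spaces.linear_iff)
  note ai = linear_additive[OF i] note aE = linear_additive[OF E]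
  have sm: "additive (s c)" "additive (s' c)" for c
    by (simp_all add: additive_def V.scale_right_distrib V'.scale_right_distrib)
  have "psubst i E (map_poly (s c) p) = s' c (psubst i E p)" for c p
  proof -
    have "psubst i E (map_poly (s c) p) = psubst (\<lambda>x. s' c (i x)) E p"
      using i by (simp add: psubst_map_poly ai aE sm Vector_Spaces.linear_iff)
    also have "\<dots> = s' c (psubst i E p)"
      using E by (intro psubst_commute) (simp_all add: ai aE sm Vector_Spaces.linear_iff)
    finally show ?thesis .
  qed
  then show ?thesis
    by (simp add: Vector_Spaces.linear_iff psubst_add ai aE V'.vector_space_axioms
        vector_space_map_poly V.vector_space_axioms)
qed

lemma linear_psubst_family:
  assumes "vector_space s" "\<And>z. Vector_Spaces.linear s s' (\<lambda>b. i b z)" "Vector_Spaces.linear s' s' E"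
  shows "Vector_Spaces.linear s s' (\<lambda>b. psubst (i b) E p)"
  unfolding psubst_def using assms
  by (intro linear_sumI linear_comp[OF linear_funpow]) (auto simp: Vector_Spaces.linear_iff)

section \<open>The ring of polynomials in \<open>\<lambda>\<close> and \<open>\<partial>\<close>\<close>

text \<open>
  The elements \<open>\<lambda>\<close>, \<open>\<partial>\<close> and \<open>\<nu> = - \<lambda> - \<partial>\<close> of \<open>k[\<lambda>, \<partial>]\<close>, where \<open>\<lambda>\<close> is the outer variable.
\<close>

definition lamv :: "'k::comm_ring_1 poly poly" where "lamv = [:0, 1:]"

definition delv :: "'k::comm_ring_1 poly poly" where "delv = [:[:0, 1:]:]"

definition nuv :: "'k::comm_ring_1 poly poly" where "nuv = - lamv - delv"

lemma indet_relations:
  "- delv - lamv = nuv" "- delv - nuv = lamv" "- nuv - lamv = delv" "- lamv - delv = nuv"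
  "- (delv + lamv) = nuv" "lamv + nuv = - delv"
  by (simp_all add: nuv_def)

lemma const2_ring: "const2 (0::'k::comm_ring_1) = 0" "const2 (a + b) = const2 a + const2 b"
  "const2 (1::'k) = 1" "const2 (a * b :: 'k) = const2 a * const2 b"
  by (simp_all add: const2_def one_pCons)

definition peval :: "'k::comm_ring_1 poly poly \<Rightarrow> 'k poly \<Rightarrow> 'k poly poly"
  where "peval e p = poly (map_poly const2 p) e"

lemma peval_0 [simp]: "peval e 0 = 0"
  by (simp add: peval_def)

lemma peval_pCons: "peval e (pCons c p) = const2 c + e * peval e p"
  by (simp add: peval_def map_poly_pCons const2_ring)

lemma peval_add: "peval e (p + q) = peval e p + peval e q"
proof -
  have "map_poly const2 (p + q) = map_poly const2 p + map_poly const2 q"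
    by (rule poly_eqI) (simp add: coeff_map_poly const2_ring)
  then show ?thesis by (simp add: peval_def)
qed

lemma peval_smult: "peval e (smult c p) = const2 c * peval e p"
proof -
  have "map_poly const2 (smult c p) = smult (const2 c) (map_poly const2 p)"
    by (rule poly_eqI) (simp add: coeff_map_poly const2_ring)
  then show ?thesis by (simp add: peval_def)
qed

text \<open>
  The functional enters \<open>\<sigma>(r)\<^sub>0\<close> through its value at \<open>- \<partial>\<close>; reflecting the polynomial
  moves the sign to the ring element.
\<close>

lemma peval_reflect: "peval e (pcompose p [:0, -1:]) = peval (- e) p"
proof (induction p)
  case (pCons c p)
  have "pcompose (pCons c p) [:0, -1:] = pCons c (- pcompose p [:0, -1:])"
    by (simp add: pcompose_pCons)
  moreover have "peval e (- q) = - peval e q" for q :: "'a poly"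
    using peval_add[of e q "- q"] by (simp add: eq_neg_iff_add_eq_0 add.commute)
  ultimately show ?case
    using pCons by (simp add: peval_pCons)
qed simp

lemma additive_peval: "additive (peval e)"
  by (simp add: additive_def peval_add)

text \<open>
  For a functional \<open>f\<close>, \<open>rsub (ev d f) e (br a b)\<close> is \<open>f\<^sub>d([a\<^sub>e b])\<close>: the bracket is taken with \<open>e\<close> for
  its variable and \<open>f\<close> is applied to the coefficients with \<open>d\<close> for its own variable.
\<close>

definition rsub :: "('v::zero \<Rightarrow> 'k::comm_ring_1 poly poly) \<Rightarrow> 'k poly poly \<Rightarrow> 'v poly \<Rightarrow> 'k poly poly"
  where "rsub h e = psubst h ((*) e)"

lemma module_times: "module ((*) :: 'r::comm_ring_1 \<Rightarrow> 'r \<Rightarrow> 'r)"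
  by unfold_locales (simp_all add: algebra_simps)

lemma psubst_const2: "psubst const2 ((*) e) p = peval e p"
  by (induction p) (simp_all add: psubst_0 psubst_pCons additive_poly_ops additive_times peval_pCons)

lemma additive_rsub: "additive h \<Longrightarrow> additive (rsub h e)"
  unfolding rsub_def by (rule additive_psubst[OF _ additive_times])

lemma rsub_pCons: "additive h \<Longrightarrow> rsub h e (pCons a p) = h a + e * rsub h e p"
  by (simp add: rsub_def psubst_pCons additive_times)

lemma rsub_0 [simp]: "additive h \<Longrightarrow> rsub h e 0 = 0"
  by (simp add: rsub_def psubst_0 additive_times)

lemma rsub_map_poly:
  assumes "additive h" "additive g" "\<And>z. h (g z) = c * h z"
  shows "rsub h e (map_poly g p) = c * rsub h e p"
  by (induction p)
    (simp_all add: rsub_pCons map_poly_pCons additive_zero[OF assms(1)] additive_zero[OF assms(2)]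
      assms algebra_simps)

lemma rsub_peval:
  "rsub (peval v) e (mul_lam t) = e * rsub (peval v) e t"
  "rsub (peval v) e (mul_mu t) = v * rsub (peval v) e t"
  "rsub (peval v) e (const2 c) = const2 c"
proof -
  show "rsub (peval v) e (mul_lam t) = e * rsub (peval v) e t"
    by (simp add: mul_lam_def rsub_pCons additive_peval)
  show "rsub (peval v) e (mul_mu t) = v * rsub (peval v) e t"
    unfolding mul_mu_def
    by (rule rsub_map_poly)
      (simp_all add: additive_peval additive_shift peval_pCons const2_ring)
  show "rsub (peval v) e (const2 c) = const2 c"
    by (simp add: const2_def[of c] rsub_pCons additive_peval peval_pCons)
qed

text \<open>
  Sending \<open>\<lambda> \<mapsto> e\<close> and \<open>\<mu> \<mapsto> v\<close> turns the variable \<open>\<mu> - \<lambda>\<close> of the functional in the definition of the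
  dual representations into \<open>v - e\<close>.
\<close>

lemma rsub_peval_psubst:
  "rsub (peval v) e (psubst const2 (\<lambda>p. mul_mu p - mul_lam p) q) = peval (v - e) q"
proof -
  have "rsub (peval v) e (psubst const2 (\<lambda>p. mul_mu p - mul_lam p) q) =
      psubst (\<lambda>c. rsub (peval v) e (const2 c)) ((*) (v - e)) q"
    by (rule psubst_transport)
      (simp_all add: additive_poly_ops additive_times additive_rsub additive_peval
        additive.diff[OF additive_rsub[OF additive_peval]] rsub_peval, simp add: left_diff_distrib)
  then show ?thesis by (simp add: rsub_peval psubst_const2)
qed

text \<open>
  \<open>ev e f z\<close> is \<open>f\<^sub>e(z)\<close>.
\<close>

definition ev :: "'k::comm_ring_1 poly poly \<Rightarrow> ('q \<Rightarrow> 'k poly) \<Rightarrow> 'q \<Rightarrow> 'k poly poly"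
  where "ev e f z = peval e (f z)"

section \<open>The action on polynomials over the module\<close>

locale kd_module = module act
  for act :: "'k::field poly \<Rightarrow> 'q::ab_group_add \<Rightarrow> 'q"
begin

text \<open>
  \<open>\<lambda>\<close> shifts the coefficients and \<open>\<partial>\<close> acts on each coefficient. Treating the operators \<open>\<lambda>\<close>, \<open>\<partial>\<close> and
  \<open>- \<lambda> - \<partial>\<close> as elements of one commutative ring makes their commutation automatic.
\<close>

definition lam_act :: "'k poly poly \<Rightarrow> 'q poly \<Rightarrow> 'q poly"
  where "lam_act q t = psubst (\<lambda>p. map_poly (act p) t) (pCons 0) q"

lemma map_act_add: "map_poly (act p) (s + t) = map_poly (act p) s + map_poly (act p) t"
  by (rule poly_eqI) (simp add: coeff_map_poly scale_right_distrib)

lemma map_act_add_left: "map_poly (act (p + q)) t = map_poly (act p) t + map_poly (act q) t"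
  by (rule poly_eqI) (simp add: coeff_map_poly scale_left_distrib)

lemma map_act_mult: "map_poly (act (p * q)) t = map_poly (act p) (map_poly (act q) t)"
  by (rule poly_eqI) (simp add: coeff_map_poly)

lemma map_act_pCons: "map_poly (act p) (pCons a t) = pCons (act p a) (map_poly (act p) t)"
  by (simp add: map_poly_pCons)

lemma map_act_0 [simp]: "map_poly (act 0) t = 0" "map_poly (act p) 0 = 0"
  by (rule poly_eqI, simp add: coeff_map_poly) simp

lemma additive_map_act: "additive (\<lambda>p. map_poly (act p) t)"
  by (simp add: additive_def map_act_add_left)

lemma lam_act_pCons: "lam_act (pCons p q) t = map_poly (act p) t + pCons 0 (lam_act q t)"
  by (simp add: lam_act_def psubst_pCons additive_map_act additive_shift)

lemma lam_act_0 [simp]: "lam_act 0 t = 0"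
  by (simp add: lam_act_def psubst_0 additive_map_act additive_shift)

lemma lam_act_add_left: "lam_act (p + q) t = lam_act p t + lam_act q t"
  by (simp add: lam_act_def psubst_add additive_map_act additive_shift)

lemma lam_act_add_right: "lam_act q (s + t) = lam_act q s + lam_act q t"
  by (induction q) (simp_all add: lam_act_pCons map_act_add algebra_simps)

lemma lam_act_smult: "lam_act (smult p q) t = map_poly (act p) (lam_act q t)"
  by (induction q) (simp_all add: lam_act_pCons map_act_mult map_act_add map_act_pCons)

lemma lam_act_mult: "lam_act (p * q) t = lam_act p (lam_act q t)"
  by (induction p) (simp_all add: lam_act_pCons lam_act_add_left lam_act_smult)

lemma map_act_1 [simp]: "map_poly (act 1) t = t"
  by (rule poly_eqI) (simp add: coeff_map_poly)

lemma module_lam_act: "module lam_act"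
  by unfold_locales
    (simp_all add: lam_act_add_left lam_act_add_right lam_act_mult lam_act_pCons one_pCons[where 'a="'k poly"])

sublocale M: module lam_act by (rule module_lam_act)

lemma lam_act_lamv: "lam_act lamv t = pCons 0 t"
  by (simp add: lamv_def lam_act_pCons)

lemma lam_act_delv: "lam_act delv t = map_poly (der act) t"
  by (simp add: delv_def lam_act_pCons der_def[abs_def])

lemma lam_act_const2: "lam_act (const2 c) t = map_poly (smul act c) t"
  by (simp add: const2_def lam_act_pCons smul_def[abs_def])

lemma lam_act_nuv: "lam_act nuv t = neg_lam_der (der act) t"
  by (simp add: nuv_def M.scale_left_diff_distrib lam_act_lamv lam_act_delv neg_lam_der_def)

lemma lam_der_lam_act: "lam_der (der act) t = lam_act (lamv + delv) t"
  by (simp add: lam_der_def M.scale_left_distrib lam_act_lamv lam_act_delv)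

lemma additive_lam_act: "additive (lam_act q)"
  by (simp add: additive_def lam_act_add_right)

text \<open>
  All sesquilinearity rules below are instances of this induction over \<open>p\<close>, with values in
  \<open>k[\<lambda>, \<partial>]\<close> or in \<open>Q[\<lambda>]\<close>.
\<close>

lemma hom_act:
  assumes mm: "module sc" and add: "additive h"
   and smul: "\<And>c a. h (smul act c a) = sc (const2 c) (h a)"
   and der: "\<And>a. h (der act a) = sc e (h a)"
  shows "h (act p a) = sc (peval e p) (h a)"
proof -
  interpret S: module sc by fact
  show ?thesis
    by (induction p)
      (simp_all add: act_pCons module_axioms additive.add[OF add] additive_zero[OF add] smul der
        peval_pCons S.scale_left_distrib)
qed

lemma psubst_const1: "psubst const1 (pCons 0) t = t" for t :: "'q poly"
  by (induction t) (simp_all add: psubst_0 psubst_pCons additive_poly_ops additive_shift, simp add: const1_def)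

lemma additive_smul: "additive (smul act c)"
  by (simp add: additive_def smul_def scale_right_distrib)

lemma additive_der': "additive (der act)"
  by (rule additive_der[OF module_axioms])

lemma additive_ev: "f \<in> cdual act \<Longrightarrow> additive (ev e f)"
  by (simp add: additive_def ev_def cdual_iff peval_add)

lemma ev_smul: "f \<in> cdual act \<Longrightarrow> ev e f (smul act c z) = const2 c * ev e f z"
  by (simp add: ev_def cdual_iff peval_smult)

lemma ev_der: "f \<in> cdual act \<Longrightarrow> ev e f (der act z) = e * ev e f z"
  by (simp add: ev_def cdual_iff peval_pCons const2_ring)

lemma rsub_ev:
  assumes f: "f \<in> cdual act"
  shows "rsub (ev d f) e (pCons 0 t) = e * rsub (ev d f) e t"
    and "rsub (ev d f) e (map_poly (smul act c) t) = const2 c * rsub (ev d f) e t"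
    and "rsub (ev d f) e (map_poly (der act) t) = d * rsub (ev d f) e t"
    and "rsub (ev d f) e (lam_der (der act) t) = (e + d) * rsub (ev d f) e t"
    and "rsub (ev d f) e (neg_lam_der (der act) t) = (- e - d) * rsub (ev d f) e t"
    and "rsub (ev d f) e (- t) = - rsub (ev d f) e t"
proof -
  note a = additive_ev[OF f]
  note ra = additive_rsub[OF a]
  show 1: "rsub (ev d f) e (pCons 0 t) = e * rsub (ev d f) e t"
    by (simp add: rsub_pCons a additive_zero[OF a])
  show "rsub (ev d f) e (map_poly (smul act c) t) = const2 c * rsub (ev d f) e t"
    by (rule rsub_map_poly) (simp_all add: a additive_smul ev_smul f)
  show 2: "rsub (ev d f) e (map_poly (der act) t) = d * rsub (ev d f) e t"
    by (rule rsub_map_poly) (simp_all add: a additive_der' ev_der f)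
  show "rsub (ev d f) e (lam_der (der act) t) = (e + d) * rsub (ev d f) e t"
    by (simp add: lam_der_def additive.add[OF ra] 1 2 algebra_simps)
  show "rsub (ev d f) e (neg_lam_der (der act) t) = (- e - d) * rsub (ev d f) e t"
    by (simp add: neg_lam_der_def additive.diff[OF ra] additive.minus[OF ra] 1 2 algebra_simps
        del: minus_pCons)
  show "rsub (ev d f) e (- t) = - rsub (ev d f) e t"
    by (rule additive.minus[OF ra])
qed

lemma const1_act: "const1 (act p v) = lam_act (peval delv p) (const1 v)"
  by (rule hom_act[OF module_lam_act])
    (simp_all add: additive_poly_ops lam_act_const2 lam_act_delv map_poly_const1
      additive_zero[OF additive_smul] additive_zero[OF additive_der'])

section \<open>The map \<open>\<sigma>(r)\<close> at \<open>\<lambda> = 0\<close>\<close>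

lemma tsum2_sum:
  assumes "finite I"
  obtains xs where "(\<Sum>i\<in>I. tens2 act (a i) (b i)) = tsum2 act xs"
    "\<And>\<beta> :: _ \<Rightarrow> _ \<Rightarrow> 'w::comm_monoid_add. (\<Sum>i\<in>I. \<beta> (a i) (b i)) = (\<Sum>(a, b)\<leftarrow>xs. \<beta> a b)"
proof -
  obtain zs where "distinct zs" "set zs = I" using finite_distinct_list[OF assms] by blast
  then show thesis
    by (intro that[of "map (\<lambda>i. (a i, b i)) zs"])
      (simp_all add: tsum2_def comp_def flip: sum.distinct_set_conv_list)
qed

lemma lift2_sum:
  assumes "bilinear_map act s \<beta>" "finite I"
  shows "lift2 act \<beta> (\<Sum>i\<in>I. tens2 act (a i) (b i)) = (\<Sum>i\<in>I. \<beta> (a i) (b i))"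
proof -
  obtain xs where "(\<Sum>i\<in>I. tens2 act (a i) (b i)) = tsum2 act xs"
    "(\<Sum>i\<in>I. \<beta> (a i) (b i)) = (\<Sum>(a, b)\<leftarrow>xs. \<beta> a b)"
    using tsum2_sum[OF assms(2)] by metis
  then show ?thesis using lift2_tsum2[OF assms(1)] by simp
qed

lemma tensor2_sum:
  assumes "r \<in> tensor2 act"
  obtains n a b where "r = (\<Sum>i\<in>{..<n::nat}. tens2 act (a i) (b i))"
proof -
  obtain xs where "r = tsum2 act xs" using assms by (auto simp: tensor2_def)
  then have "r = (\<Sum>i\<in>{..<length xs}. tens2 act (fst (xs ! i)) (snd (xs ! i)))"
    by (simp add: tsum2_def sum_list_sum_nth atLeast0LessThan split_def)
  then show thesis by (rule that)
qed

text \<open>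
  \<open>\<sigma>(\<Sum>\<^sub>i u\<^sub>i \<otimes> v\<^sub>i)\<^sub>0 g = \<Sum>\<^sub>i g\<^bsub>- \<partial>\<^esub>(u\<^sub>i) v\<^sub>i\<close>. In contrast to \<open>\<sigma>\<close> this is additive in an
  arbitrary function \<open>g\<close>, not only on the conformal dual.
\<close>

definition sigma0_of :: "'i set \<Rightarrow> ('i \<Rightarrow> 'q) \<Rightarrow> ('i \<Rightarrow> 'q) \<Rightarrow> ('q \<Rightarrow> 'k poly) \<Rightarrow> 'q"
  where "sigma0_of I u v g = (\<Sum>i\<in>I. act (pcompose (g (u i)) [:0, -1:]) (v i))"

lemma sigma0_of_add: "sigma0_of I u v (f + g) = sigma0_of I u v f + sigma0_of I u v g"
  by (simp add: sigma0_of_def pcompose_add scale_left_distrib sum.distrib)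

lemma additive_sigma0_of: "additive (sigma0_of I u v)"
  by (simp add: additive_def sigma0_of_add)

lemma sigma0_of_der: "sigma0_of I u v (der dual_act g) = der act (sigma0_of I u v g)"
proof -
  have "act (- ([:0, -1:] * p)) w = der act (act p w)" for p w
    by (simp add: der_def)
  then show ?thesis
    by (simp add: sigma0_of_def der_dual_act pcompose_uminus pcompose_pCons additive.sum[OF additive_der'])
qed

lemma coeff_sigma:
  "coeff (psubst (\<lambda>c. const1 (smul act c b)) (neg_lam_der (der act)) q) 0 = act (pcompose q [:0, -1:]) b"
proof -
  interpret vs: vector_space "smul act" by (rule vector_space_smul[OF module_axioms])
  have i: "additive (\<lambda>c. const1 (smul act c b))"
    by (simp add: additive_def const1_def vs.scale_left_distrib)
  show ?thesis
  proof (induction q)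
    case 0
    then show ?case by (simp add: psubst_0 i additive_neg_lam_der additive_der')
  next
    case (pCons c q)
    have "act (pcompose (pCons c q) [:0, -1:]) b = act (pCons c (- pcompose q [:0, -1:])) b"
      by (simp add: pcompose_pCons)
    also have "\<dots> = smul act c b - der act (act (pcompose q [:0, -1:]) b)"
      by (simp add: act_pCons module_axioms additive.minus[OF additive_der'])
    finally have "act (pcompose (pCons c q) [:0, -1:]) b =
        smul act c b - der act (act (pcompose q [:0, -1:]) b)" .
    moreover have "coeff (neg_lam_der (der act) t) 0 = - der act (coeff t 0)" for t
      by (simp add: neg_lam_der_def coeff_map_poly additive_zero[OF additive_der'])
    moreover have "coeff (const1 w) 0 = w" for w :: 'q
      by (simp add: const1_def)
    ultimately show ?case
      using pCons by (simp add: psubst_pCons i additive_neg_lam_der additive_der')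
  qed
qed

lemma sigma0_sum:
  assumes "g \<in> cdual act" "finite I"
  shows "sigma0 act (\<Sum>i\<in>I. tens2 act (u i) (v i)) g = sigma0_of I u v g"
  unfolding sigma0_def sigma_def lift2_sum[OF sigma_bilinear[OF module_axioms assms(1)] assms(2)]
  by (simp add: coeff_sum coeff_sigma sigma0_of_def)

text \<open>
  Applying \<open>\<sigma>(r)\<^sub>0\<close> to a polynomial of functionals specialises the variable of each functional to
  \<open>- \<partial>\<close>. In the first of the next two lemmas \<open>\<lambda>\<close> is kept, in the second one it is replaced by
  \<open>- \<lambda> - \<partial>\<close>; the latter uses that \<open>\<sigma>(r)\<^sub>0\<close> commutes with \<open>\<partial>\<close>.
\<close>

lemma sigma0_of_subst:
  "psubst (\<lambda>g. const1 (sigma0_of I u v g)) (lam_act e) P =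
    (\<Sum>i\<in>I. lam_act (rsub (\<lambda>g. peval (- delv) (g (u i))) e P) (const1 (v i)))"
proof -
  have 1: "additive (\<lambda>g. const1 (sigma0_of I u v g))"
    by (simp add: additive_def sigma0_of_add const1_def)
  have 2: "additive (\<lambda>g. peval (- delv) (g (u i)))" for i
    by (simp add: additive_def peval_add)
  have 3: "const1 (sigma0_of I u v g) = (\<Sum>i\<in>I. lam_act (peval (- delv) (g (u i))) (const1 (v i)))" for g
    by (simp add: sigma0_of_def additive.sum[OF additive_poly_ops(3)] const1_act peval_reflect)
  show ?thesis
  proof (induction P)
    case 0
    show ?case by (simp add: psubst_0 1 2 additive_lam_act)
  next
    case (pCons g P)
    have "psubst (\<lambda>g. const1 (sigma0_of I u v g)) (lam_act e) (pCons g P) =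
        const1 (sigma0_of I u v g) + lam_act e (psubst (\<lambda>g. const1 (sigma0_of I u v g)) (lam_act e) P)"
      by (rule psubst_pCons[OF 1 additive_lam_act])
    then show ?case
      unfolding pCons.IH
      by (simp add: 3 rsub_pCons 2 M.scale_left_distrib M.scale_sum_right sum.distrib)
  qed
qed

lemma map_sigma0_of:
  "map_poly (sigma0_of I u v) P =
    (\<Sum>i\<in>I. lam_act (rsub (\<lambda>g. peval (- delv) (g (u i))) lamv P) (const1 (v i)))"
proof -
  have 1: "additive (\<lambda>g. const1 (sigma0_of I u v g))"
    by (simp add: additive_def sigma0_of_add const1_def)
  have "psubst (\<lambda>g. const1 (sigma0_of I u v g)) (pCons 0) P = map_poly (sigma0_of I u v) P"
    by (induction P)
      (simp_all add: psubst_0 psubst_pCons 1 additive_shift map_poly_pCons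
        additive_zero[OF additive_sigma0_of], simp add: const1_def)
  moreover have "lam_act lamv = pCons 0"
    by (rule ext) (rule lam_act_lamv)
  ultimately show ?thesis
    by (metis sigma0_of_subst)
qed

lemma map_sigma0_of_neg_lam_der:
  "map_poly (sigma0_of I u v) (psubst const1 (neg_lam_der (der dual_act)) P) =
    (\<Sum>i\<in>I. lam_act (rsub (\<lambda>g. peval (- delv) (g (u i))) nuv P) (const1 (v i)))"
proof -
  have dd: "additive (der dual_act)" by (rule additive_der[OF module_dual_act])
  have "map_poly (sigma0_of I u v) (neg_lam_der (der dual_act) t) = lam_act nuv (map_poly (sigma0_of I u v) t)" for t
    by (rule poly_eqI)
      (simp add: lam_act_nuv neg_lam_der_def coeff_map_poly additive_zero[OF additive_sigma0_of]
        additive_zero[OF additive_der'] additive_zero[OF dd] additive.diff[OF additive_sigma0_of]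
        additive.minus[OF additive_sigma0_of] sigma0_of_der coeff_pCons split: nat.split)
  then have "map_poly (sigma0_of I u v) (psubst const1 (neg_lam_der (der dual_act)) P) =
      psubst (\<lambda>g. map_poly (sigma0_of I u v) (const1 g)) (lam_act nuv) P"
    by (intro psubst_transport)
      (simp_all add: additive_poly_ops additive_neg_lam_der dd additive_lam_act additive_map_poly additive_sigma0_of)
  then show ?thesis by (simp add: map_poly_const1 additive_zero[OF additive_sigma0_of] sigma0_of_subst)
qed

text \<open>
  \<open>\<sigma>(r)\<^sub>0\<close> is given by \<open>sigma0_of\<close> only on the conformal dual, so the coefficients of the polynomials to
  which it is applied have to be conformal functionals.
\<close>

lemma coeff_psubst_cdual:
  assumes "\<And>n. coeff P n \<in> cdual act"
  shows "coeff (psubst const1 (neg_lam_der (der dual_act)) P) n \<in> cdual act"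
proof -
  let ?S = "{P. \<forall>n. coeff P n \<in> cdual act}"
  have cl: "0 \<in> cdual act" "f \<in> cdual act \<Longrightarrow> g \<in> cdual act \<Longrightarrow> f + g \<in> cdual act"
    "f \<in> cdual act \<Longrightarrow> - f \<in> cdual act" "f \<in> cdual act \<Longrightarrow> der dual_act f \<in> cdual act" for f g
    by (simp_all add: cdual_iff der_dual_act smult_add_right)
  have "neg_lam_der (der dual_act) t \<in> ?S" if "t \<in> ?S" for t
    using that cl(3)[OF cl(4)]
    by (auto simp: neg_lam_der_def coeff_map_poly additive_zero[OF additive_der[OF module_dual_act]]
        coeff_pCons cl diff_conv_add_uminus simp del: add_uminus_conv_diff split: nat.split)
  moreover have "const1 (coeff P n) \<in> ?S" for n
    using assms by (auto simp: const1_def coeff_pCons cl split: nat.split)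
  ultimately have "psubst const1 (neg_lam_der (der dual_act)) P \<in> ?S"
    by (intro psubst_transport_on(1)[where h = id and E' = "neg_lam_der (der dual_act)"])
      (use cl in auto)
  then show ?thesis by simp
qed

section \<open>Tensors\<close>

text \<open>
  Tensors are added as elements of a group and not pointwise as functions on forms.
\<close>

declare plus_fun_apply [simp del] zero_fun_apply [simp del]

abbreviation "tens3_scale \<equiv> (\<lambda>c (t :: ('k, 'q) tens3) B. c * t B)"

abbreviation "tens2_scale \<equiv> (\<lambda>c (t :: ('k, 'q) tens2) B. c * t B)"

abbreviation "poly_scale \<equiv> (\<lambda>c. map_poly (smul act c))"

lemma vector_spaces: "vector_space tens3_scale" "vector_space tens2_scale" "vector_space (smul act)" "vector_space poly_scale"
proof -
  show "vector_space tens3_scale" "vector_space tens2_scale"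
    by (unfold_locales; simp add: fun_eq_iff plus_fun_apply algebra_simps)+
qed (simp_all add: vector_space_smul module_axioms vector_space_map_poly)

lemma linear_tens3:
  "Vector_Spaces.linear (smul act) tens3_scale (\<lambda>a. tens3 act a b c)"
  "Vector_Spaces.linear (smul act) tens3_scale (\<lambda>b. tens3 act a b c)"
  "Vector_Spaces.linear (smul act) tens3_scale (\<lambda>c. tens3 act a b c)"
  using trilinear_map_tens3[OF module_axioms] by (simp_all add: trilinear_map_def)

lemma linear_tens2:
  "Vector_Spaces.linear (smul act) tens2_scale (\<lambda>a. tens2 act a b)"
  "Vector_Spaces.linear (smul act) tens2_scale (\<lambda>b. tens2 act a b)"
  using bilinear_map_tens2[OF module_axioms] by (simp_all add: bilinear_map_def)

lemma tens3_add:
  "tens3 act (a + a') b c = tens3 act a b c + tens3 act a' b c"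
  "tens3 act a (b + b') c = tens3 act a b c + tens3 act a b' c"
  "tens3 act a b (c + c') = tens3 act a b c + tens3 act a b c'"
  using additive.add[OF linear_additive[OF linear_tens3(1)]] additive.add[OF linear_additive[OF linear_tens3(2)]]
    additive.add[OF linear_additive[OF linear_tens3(3)]] by auto

text \<open>
  The derivations \<open>\<partial>\<^sub>i\<close> as precomposition with \<open>\<partial>\<close> in the \<open>i\<close>-th argument of a form. They agree with
  \<open>der3_1\<close>, \<open>der3_2\<close>, \<open>der3_3\<close> (and \<open>d2_sum\<close> with \<open>der2\<close>) on tensors, but they are linear
  on the whole function type, so that the rules for substitution apply to them.
\<close>

definition d3_1 :: "('k, 'q) tens3 \<Rightarrow> ('k, 'q) tens3" where
  "d3_1 t = (\<lambda>T. if trilinear_map act (*) T then t (\<lambda>a b c. T (der act a) b c) else 0)"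

definition d3_2 :: "('k, 'q) tens3 \<Rightarrow> ('k, 'q) tens3" where
  "d3_2 t = (\<lambda>T. if trilinear_map act (*) T then t (\<lambda>a b c. T a (der act b) c) else 0)"

definition d3_3 :: "('k, 'q) tens3 \<Rightarrow> ('k, 'q) tens3" where
  "d3_3 t = (\<lambda>T. if trilinear_map act (*) T then t (\<lambda>a b c. T a b (der act c)) else 0)"

definition d2_sum :: "('k, 'q) tens2 \<Rightarrow> ('k, 'q) tens2" where
  "d2_sum t = (\<lambda>B. if bilinear_map act (*) B then t (\<lambda>a b. B (der act a) b + B a (der act b)) else 0)"

lemma linear_d:
  "Vector_Spaces.linear tens3_scale tens3_scale d3_1"
  "Vector_Spaces.linear tens3_scale tens3_scale d3_2"
  "Vector_Spaces.linear tens3_scale tens3_scale d3_3"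
  "Vector_Spaces.linear tens2_scale tens2_scale d2_sum"
  by (auto simp: Vector_Spaces.linear_iff vector_spaces fun_eq_iff plus_fun_apply
      d3_1_def d3_2_def d3_3_def d2_sum_def)

lemma linear_der': "Vector_Spaces.linear (smul act) (smul act) (der act)"
  by (rule linear_der[OF module_axioms])

lemma d3_tens3:
  "d3_1 (tens3 act a b c) = tens3 act (der act a) b c"
  "d3_2 (tens3 act a b c) = tens3 act a (der act b) c"
  "d3_3 (tens3 act a b c) = tens3 act a b (der act c)"
proof -
  have "trilinear_map act (*) (\<lambda>a b c. T (der act a) b c)"
    "trilinear_map act (*) (\<lambda>a b c. T a (der act b) c)"
    "trilinear_map act (*) (\<lambda>a b c. T a b (der act c))" if "trilinear_map act (*) T" for T
    using that unfolding trilinear_map_def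
    by (intro conjI allI linear_comp[OF _ linear_der']; blast)+
  then show "d3_1 (tens3 act a b c) = tens3 act (der act a) b c"
    "d3_2 (tens3 act a b c) = tens3 act a (der act b) c"
    "d3_3 (tens3 act a b c) = tens3 act a b (der act c)"
    by (auto simp: d3_1_def d3_2_def d3_3_def tens3_def fun_eq_iff)
qed

lemma d2_sum_tens: "d2_sum (tens2 act a b) = tens2 act (der act a) b + tens2 act a (der act b)"
proof -
  have "bilinear_map act (*) (\<lambda>a b. T (der act a) b + T a (der act b))"
    if "bilinear_map act (*) T" for T
  proof -
    have "Vector_Spaces.linear (smul act) (*) (\<lambda>a. T a b)" "Vector_Spaces.linear (smul act) (*) (\<lambda>b. T a b)" for a b
      using that by (simp_all add: bilinear_map_def)
    then show ?thesis
      unfolding bilinear_map_def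
      using linear_addI(1) linear_comp[OF _ linear_der'] by (intro conjI allI linear_addI(1)) blast+
  qed
  then show ?thesis
    by (auto simp: d2_sum_def tens2_def fun_eq_iff plus_fun_apply)
qed

lemma tensor3_closed:
  "0 \<in> tensor3 act" "tens3 act a b c \<in> tensor3 act"
  "s \<in> tensor3 act \<Longrightarrow> t \<in> tensor3 act \<Longrightarrow> s + t \<in> tensor3 act"
proof -
  show "0 \<in> tensor3 act" unfolding tensor3_def by (rule range_eqI[of _ _ "[]"]) (simp add: tsum3_def)
  show "tens3 act a b c \<in> tensor3 act"
    unfolding tensor3_def by (rule range_eqI[of _ _ "[(a, b, c)]"]) (simp add: tsum3_def)
  assume "s \<in> tensor3 act" "t \<in> tensor3 act"
  then obtain xs ys where "s = tsum3 act xs" "t = tsum3 act ys" by (auto simp: tensor3_def)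
  then show "s + t \<in> tensor3 act"
    unfolding tensor3_def by (intro range_eqI[of _ _ "xs @ ys"]) (simp add: tsum3_def)
qed

lemma tensor3_induct [consumes 1, case_names zero add]:
  assumes "t \<in> tensor3 act" "P 0"
    "\<And>a b c t. t \<in> tensor3 act \<Longrightarrow> P t \<Longrightarrow> P (tens3 act a b c + t)"
  shows "P t"
proof -
  have "P (tsum3 act xs)" for xs
  proof (induction xs)
    case (Cons x xs)
    obtain a b c where "x = (a, b, c)" by (cases x)
    with Cons assms(3)[of "tsum3 act xs" a b c] show ?case
      by (simp add: tsum3_def tensor3_def)
  qed (simp add: tsum3_def assms)
  then show ?thesis using assms(1) by (auto simp: tensor3_def)
qed

lemma tensor2_closed:
  "0 \<in> tensor2 act" "tens2 act a b \<in> tensor2 act"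
  "s \<in> tensor2 act \<Longrightarrow> t \<in> tensor2 act \<Longrightarrow> s + t \<in> tensor2 act"
proof -
  show "0 \<in> tensor2 act" unfolding tensor2_def by (rule range_eqI[of _ _ "[]"]) (simp add: tsum2_def)
  show "tens2 act a b \<in> tensor2 act"
    unfolding tensor2_def by (rule range_eqI[of _ _ "[(a, b)]"]) (simp add: tsum2_def)
  assume "s \<in> tensor2 act" "t \<in> tensor2 act"
  then obtain xs ys where "s = tsum2 act xs" "t = tsum2 act ys" by (auto simp: tensor2_def)
  then show "s + t \<in> tensor2 act"
    unfolding tensor2_def by (intro range_eqI[of _ _ "xs @ ys"]) (simp add: tsum2_def)
qed

lemma tensor2_induct [consumes 1, case_names zero add]:
  assumes "t \<in> tensor2 act" "P 0"
    "\<And>a b t. t \<in> tensor2 act \<Longrightarrow> P t \<Longrightarrow> P (tens2 act a b + t)"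
  shows "P t"
proof -
  have "P (tsum2 act xs)" for xs
  proof (induction xs)
    case (Cons x xs)
    obtain a b where "x = (a, b)" by (cases x)
    with Cons assms(3)[of "tsum2 act xs" a b] show ?case
      by (simp add: tsum2_def tensor2_def)
  qed (simp add: tsum2_def assms)
  then show ?thesis using assms(1) by (auto simp: tensor2_def)
qed

lemma lift3_add:
  assumes "trilinear_map act s \<beta>" "t \<in> tensor3 act" "t' \<in> tensor3 act"
  shows "lift3 act \<beta> (t + t') = lift3 act \<beta> t + lift3 act \<beta> t'"
proof -
  obtain xs ys where xs: "t = tsum3 act xs" "t' = tsum3 act ys" using assms by (auto simp: tensor3_def)
  then have "t + t' = tsum3 act (xs @ ys)" by (simp add: tsum3_def)
  then show ?thesis by (simp add: xs lift3_tsum3[OF assms(1)])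
qed

lemma lift3_tens: "trilinear_map act s \<beta> \<Longrightarrow> lift3 act \<beta> (tens3 act a b c) = \<beta> a b c"
  "trilinear_map act s \<beta> \<Longrightarrow> lift3 act \<beta> 0 = 0"
  using lift3_tsum3[of act s \<beta> "[(a, b, c)]"] lift3_tsum3[of act s \<beta> "[]"] by (simp_all add: tsum3_def)

lemma lift2_add:
  assumes "bilinear_map act s \<beta>" "t \<in> tensor2 act" "t' \<in> tensor2 act"
  shows "lift2 act \<beta> (t + t') = lift2 act \<beta> t + lift2 act \<beta> t'"
proof -
  obtain xs ys where xs: "t = tsum2 act xs" "t' = tsum2 act ys" using assms by (auto simp: tensor2_def)
  then have "t + t' = tsum2 act (xs @ ys)" by (simp add: tsum2_def)
  then show ?thesis by (simp add: xs lift2_tsum2[OF assms(1)])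
qed

lemma lift2_tens: "bilinear_map act s \<beta> \<Longrightarrow> lift2 act \<beta> (tens2 act a b) = \<beta> a b"
  "bilinear_map act s \<beta> \<Longrightarrow> lift2 act \<beta> 0 = 0"
  using lift2_tsum2[of act s \<beta> "[(a, b)]"] lift2_tsum2[of act s \<beta> "[]"] by (simp_all add: tsum2_def)

lemma tensor3_hom:
  assumes "t \<in> tensor3 act" "\<And>a b c. f (tens3 act a b c) \<in> tensor3 act" "additive f"
  shows "f t \<in> tensor3 act"
  using assms(1)
  by (induction rule: tensor3_induct)
    (simp_all add: additive_zero[OF assms(3)] additive.add[OF assms(3)] tensor3_closed assms(2))

lemma tensor2_hom:
  assumes "t \<in> tensor2 act" "\<And>a b. f (tens2 act a b) \<in> tensor2 act" "additive f"
  shows "f t \<in> tensor2 act"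
  using assms(1)
  by (induction rule: tensor2_induct)
    (simp_all add: additive_zero[OF assms(3)] additive.add[OF assms(3)] tensor2_closed assms(2))

lemma additive_d: "additive d3_1" "additive d3_2" "additive d3_3" "additive d2_sum"
  using linear_d linear_additive by blast+

lemma d3_tensor3:
  "t \<in> tensor3 act \<Longrightarrow> d3_1 t \<in> tensor3 act" "t \<in> tensor3 act \<Longrightarrow> d3_2 t \<in> tensor3 act"
  "t \<in> tensor3 act \<Longrightarrow> d3_3 t \<in> tensor3 act"
  by (erule tensor3_hom; simp add: d3_tens3 tensor3_closed additive_d)+

lemma d2_sum_tensor: "t \<in> tensor2 act \<Longrightarrow> d2_sum t \<in> tensor2 act"
  by (erule tensor2_hom; simp add: d2_sum_tens tensor2_closed additive_d)

lemma tens_minus: "- tens3 act a b c = tens3 act (- a) b c" "- tens2 act a b = tens2 act (- a) b"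
  using additive.minus[OF linear_additive[OF linear_tens3(1)]] additive.minus[OF linear_additive[OF linear_tens2(1)]]
  by auto

lemma tensor_minus: "t \<in> tensor3 act \<Longrightarrow> - t \<in> tensor3 act" "s \<in> tensor2 act \<Longrightarrow> - s \<in> tensor2 act"
proof -
  have u: "additive (uminus :: 'z::ab_group_add \<Rightarrow> 'z)"
    by (simp add: additive_def)
  show "t \<in> tensor3 act \<Longrightarrow> - t \<in> tensor3 act"
    by (erule tensor3_hom[of _ uminus, OF _ _ u]) (simp add: tens_minus tensor3_closed)
  show "s \<in> tensor2 act \<Longrightarrow> - s \<in> tensor2 act"
    by (erule tensor2_hom[of _ uminus, OF _ _ u]) (simp add: tens_minus tensor2_closed)
qed

lemma tensor_diff: "t \<in> tensor3 act \<Longrightarrow> t' \<in> tensor3 act \<Longrightarrow> t - t' \<in> tensor3 act"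
   "s \<in> tensor2 act \<Longrightarrow> s' \<in> tensor2 act \<Longrightarrow> s - s' \<in> tensor2 act"
  using tensor3_closed(3)[OF _ tensor_minus(1)] tensor2_closed(3)[OF _ tensor_minus(2)] by fastforce+

lemma lift3_diff:
  assumes "trilinear_map act s \<beta>" "t \<in> tensor3 act" "t' \<in> tensor3 act"
  shows "lift3 act \<beta> (t - t') = lift3 act \<beta> t - lift3 act \<beta> t'"
  using lift3_add[OF assms(1) tensor_diff(1)[OF assms(2,3)] assms(3)] by (simp add: eq_diff_eq)

lemma lift2_diff:
  assumes "bilinear_map act s \<beta>" "t \<in> tensor2 act" "t' \<in> tensor2 act"
  shows "lift2 act \<beta> (t - t') = lift2 act \<beta> t - lift2 act \<beta> t'"
  using lift2_add[OF assms(1) tensor_diff(2)[OF assms(2,3)] assms(3)] by (simp add: eq_diff_eq)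

lemma der3_eq_d3:
  assumes "t \<in> tensor3 act"
  shows "der3_1 act t = d3_1 t" "der3_2 act t = d3_2 t" "der3_3 act t = d3_3 t"
proof -
  obtain xs where t: "t = tsum3 act xs" using assms by (auto simp: tensor3_def)
  have *: "f (tsum3 act xs) = (\<Sum>(a, b, c)\<leftarrow>xs. f (tens3 act a b c))" if "additive f"
    for f :: "('k, 'q) tens3 \<Rightarrow> ('k, 'q) tens3"
    unfolding tsum3_def by (induction xs) (auto simp: additive_zero[OF that] additive.add[OF that])
  show "der3_1 act t = d3_1 t" "der3_2 act t = d3_2 t" "der3_3 act t = d3_3 t"
    by (simp_all add: t *[OF additive_d(1)] *[OF additive_d(2)] *[OF additive_d(3)] d3_tens3
        der3_1_tsum3 der3_2_tsum3 der3_3_tsum3 module_axioms)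
qed

lemma der2_eq_d2_sum:
  assumes "t \<in> tensor2 act"
  shows "der2 act t = d2_sum t"
proof -
  obtain xs where t: "t = tsum2 act xs" using assms by (auto simp: tensor2_def)
  have *: "f (tsum2 act xs) = (\<Sum>(a, b)\<leftarrow>xs. f (tens2 act a b))" if "additive f"
    for f :: "('k, 'q) tens2 \<Rightarrow> ('k, 'q) tens2"
    unfolding tsum2_def by (induction xs) (auto simp: additive_zero[OF that] additive.add[OF that])
  show "der2 act t = d2_sum t"
    by (simp add: t *[OF additive_d(4)] d2_sum_tens der2_tsum2 module_axioms)
qed

section \<open>Tensors that are divisible by the total derivation\<close>

text \<open>
  The functional \<open>e m\<close> is the coordinate at the basis element \<open>m\<close>, read as a polynomial in \<open>\<lambda>\<close> instead of
  \<open>\<partial>\<close>. Only the finitely many basis elements that occur in a finite generating set matter.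
\<close>

lemma finite_dual_basis:
  assumes fg: "fg_module act" and fr: "free_module act"
  obtains C e where "finite C" "\<And>m. e m \<in> cdual act" "\<And>v. (\<Sum>m\<in>C. act (e m v) m) = v"
proof -
  obtain B where B: "independent B" "span B = UNIV" using fr by (auto simp: free_module_def)
  obtain S where S: "finite S" "span S = UNIV" using fg by (auto simp: fg_module_def)
  define e where "e m v = representation B v m" for m v
  have e_add: "e m (u + v) = e m u + e m v" for m u v
    by (simp add: e_def representation_add B)
  have e_act: "e m (act p v) = p * e m v" for m p v
    by (simp add: e_def representation_scale B)
  \<comment> \<open>the basis elements that occur in the generators\<close>
  define C where "C = (\<Union>s\<in>S. {m. e m s \<noteq> 0})"
  have C: "finite C" using S(1) by (auto simp: C_def e_def finite_representation)
  have "subspace {v. \<forall>m. m \<notin> C \<longrightarrow> e m v = 0}"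
    using e_act[of _ 0 0] by (auto simp: subspace_def e_add e_act)
  moreover have "S \<subseteq> {v. \<forall>m. m \<notin> C \<longrightarrow> e m v = 0}"
    by (auto simp: C_def)
  ultimately have "span S \<subseteq> {v. \<forall>m. m \<notin> C \<longrightarrow> e m v = 0}"
    by (intro span_minimal)
  then have z: "e m v = 0" if "m \<notin> C" for m v using that S(2) by auto
  have "(\<Sum>m\<in>C. act (e m v) m) = v" for v
  proof -
    have "(\<Sum>m\<in>C. act (e m v) m) = (\<Sum>m | e m v \<noteq> 0. act (e m v) m)"
      by (rule sum.mono_neutral_right) (use C z in auto)
    then show ?thesis using sum_nonzero_representation_eq[of B v] B by (simp add: e_def)
  qed
  moreover have "e m \<in> cdual act" for m
    by (simp add: cdual_iff e_add smul_def der_def e_act)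
  ultimately show thesis using that C by blast
qed

lemma linear_lam_act_const1: "Vector_Spaces.linear (smul act) poly_scale (\<lambda>u. lam_act q (const1 u))"
proof -
  have "poly_scale c (lam_act q (const1 u)) = lam_act q (poly_scale c (const1 u))" for c u
    by (simp add: mult.commute flip: lam_act_const2)
  moreover have "const1 (smul act c u) = poly_scale c (const1 u)" for c u
    by (simp add: map_poly_const1 additive_zero[OF additive_smul])
  ultimately show ?thesis
    by (simp add: Vector_Spaces.linear_iff vector_spaces additive.add[OF additive_poly_ops(3)] M.scale_right_distrib)
qed

lemma linear_lam_act_ev:
  assumes "f \<in> cdual act"
  shows "Vector_Spaces.linear (smul act) poly_scale (\<lambda>z. lam_act (ev e f z * q) t)"
   "Vector_Spaces.linear (smul act) poly_scale (\<lambda>z. lam_act (q * ev e f z) t)"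
   "Vector_Spaces.linear (smul act) poly_scale (\<lambda>z. lam_act (ev e f z) t)"
  by (auto simp: Vector_Spaces.linear_iff vector_spaces additive.add[OF additive_ev[OF assms]]
      ev_smul[OF assms] M.scale_left_distrib algebra_simps simp flip: lam_act_const2)

definition pairing :: "('q \<Rightarrow> 'k poly) \<Rightarrow> ('q \<Rightarrow> 'k poly) \<Rightarrow> 'q \<Rightarrow> 'q \<Rightarrow> 'q \<Rightarrow> 'q poly"
  where "pairing x y u v w = lam_act (ev lamv x v * ev nuv y w) (const1 u)"

lemma trilinear_pairing:
  assumes "x \<in> cdual act" "y \<in> cdual act"
  shows "trilinear_map act poly_scale (pairing x y)"
  unfolding trilinear_map_def pairing_def
  using linear_lam_act_const1 linear_lam_act_ev[OF assms(1)] linear_lam_act_ev[OF assms(2)] by auto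

definition pair3 :: "('q \<Rightarrow> 'k poly) \<Rightarrow> ('q \<Rightarrow> 'k poly) \<Rightarrow> ('k, 'q) tens3 \<Rightarrow> 'q poly"
  where "pair3 x y = lift3 act (pairing x y)"

context
  fixes x y :: "'q \<Rightarrow> 'k poly"
  assumes x: "x \<in> cdual act" and y: "y \<in> cdual act"
begin

lemma pair3_tens: "pair3 x y (tens3 act u v w) = pairing x y u v w"
  unfolding pair3_def by (rule lift3_tens[OF trilinear_pairing[OF x y]])

lemma pair3_0: "pair3 x y 0 = 0"
  unfolding pair3_def by (rule lift3_tens[OF trilinear_pairing[OF x y]])

lemma pair3_add: "s \<in> tensor3 act \<Longrightarrow> t \<in> tensor3 act \<Longrightarrow> pair3 x y (s + t) = pair3 x y s + pair3 x y t"
  unfolding pair3_def by (rule lift3_add[OF trilinear_pairing[OF x y]])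

lemma pair3_diff: "s \<in> tensor3 act \<Longrightarrow> t \<in> tensor3 act \<Longrightarrow> pair3 x y (s - t) = pair3 x y s - pair3 x y t"
  unfolding pair3_def by (rule lift3_diff[OF trilinear_pairing[OF x y]])

lemma pair3_sum: "(\<And>i. i \<in> I \<Longrightarrow> t i \<in> tensor3 act) \<Longrightarrow> sum t I \<in> tensor3 act \<and> pair3 x y (sum t I) = (\<Sum>i\<in>I. pair3 x y (t i))"
  by (induction I rule: infinite_finite_induct) (auto simp: pair3_0 pair3_add tensor3_closed)

lemma pairing_der:
  "pairing x y (der act u) v w = lam_act delv (pairing x y u v w)"
  "pairing x y u (der act v) w = lam_act lamv (pairing x y u v w)"
  "pairing x y u v (der act w) = lam_act nuv (pairing x y u v w)"
proof -
  have "const1 (der act u) = lam_act delv (const1 u)"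
    by (simp add: lam_act_delv map_poly_const1 additive_zero[OF additive_der'])
  then show "pairing x y (der act u) v w = lam_act delv (pairing x y u v w)"
    by (simp add: pairing_def mult.commute)
qed (simp_all add: pairing_def ev_der x y mult_ac)

lemma pair3_d3:
  assumes "t \<in> tensor3 act"
  shows "pair3 x y (d3_1 t) = lam_act delv (pair3 x y t)"
    "pair3 x y (d3_2 t) = lam_act lamv (pair3 x y t)"
    "pair3 x y (d3_3 t) = lam_act nuv (pair3 x y t)"
  using assms
  by (induction rule: tensor3_induct)
    (simp_all add: additive_zero[OF additive_d(1)] additive_zero[OF additive_d(2)] additive_zero[OF additive_d(3)]
      additive.add[OF additive_d(1)] additive.add[OF additive_d(2)] additive.add[OF additive_d(3)]
      pair3_0 pair3_add tensor3_closed d3_tensor3 d3_tens3 pair3_tens pairing_der M.scale_right_distrib)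

lemma pair3_psubst:
  assumes "\<And>z. i z \<in> tensor3 act" "\<And>t. t \<in> tensor3 act \<Longrightarrow> E t \<in> tensor3 act"
    "\<And>t. t \<in> tensor3 act \<Longrightarrow> pair3 x y (E t) = lam_act e (pair3 x y t)"
  shows "pair3 x y (psubst i E p) = psubst (\<lambda>z. pair3 x y (i z)) (lam_act e) p"
    "psubst i E p \<in> tensor3 act"
  using psubst_transport_on[of "tensor3 act" E i p "pair3 x y" "lam_act e"]
  by (simp_all add: assms tensor3_closed pair3_add pair3_0)

end

definition d3_sum :: "('k, 'q) tens3 \<Rightarrow> ('k, 'q) tens3" where "d3_sum t = d3_1 t + d3_2 t + d3_3 t"

lemma der3_d3_sum: "t \<in> tensor3 act \<Longrightarrow> der3 act t = d3_sum t"
  by (simp add: der3_def d3_sum_def der3_eq_d3)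

lemma additive_d3_sum: "additive d3_sum"
  by (simp add: additive_def d3_sum_def additive.add[OF additive_d(1)] additive.add[OF additive_d(2)]
    additive.add[OF additive_d(3)])

lemma image_der3: "der3 act ` tensor3 act = d3_sum ` tensor3 act"
  by (rule image_cong) (simp_all add: der3_d3_sum)

lemma d3_sum_commute: "t \<in> tensor3 act \<Longrightarrow> d3_sum (d3_1 t) = d3_1 (d3_sum t)" "t \<in> tensor3 act \<Longrightarrow> d3_sum (d3_2 t) = d3_2 (d3_sum t)"
proof -
  note a = additive.add[OF additive_d(1)] additive.add[OF additive_d(2)] additive.add[OF additive_d(3)]
    additive_zero[OF additive_d(1)] additive_zero[OF additive_d(2)] additive_zero[OF additive_d(3)]
  show "t \<in> tensor3 act \<Longrightarrow> d3_sum (d3_1 t) = d3_1 (d3_sum t)" "t \<in> tensor3 act \<Longrightarrow> d3_sum (d3_2 t) = d3_2 (d3_sum t)"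
    by (induction rule: tensor3_induct; simp add: d3_sum_def a d3_tens3)+
qed

lemma image_d3_sum_closed:
  "0 \<in> d3_sum ` tensor3 act"
  "s \<in> d3_sum ` tensor3 act \<Longrightarrow> t \<in> d3_sum ` tensor3 act \<Longrightarrow> s + t \<in> d3_sum ` tensor3 act"
  "s \<in> d3_sum ` tensor3 act \<Longrightarrow> - s \<in> d3_sum ` tensor3 act"
  "s \<in> d3_sum ` tensor3 act \<Longrightarrow> d3_1 s \<in> d3_sum ` tensor3 act"
  "s \<in> d3_sum ` tensor3 act \<Longrightarrow> d3_2 s \<in> d3_sum ` tensor3 act"
proof -
  show "0 \<in> d3_sum ` tensor3 act"
    using additive_zero[OF additive_d3_sum] tensor3_closed(1) by (metis image_eqI)
  show "s + t \<in> d3_sum ` tensor3 act" if "s \<in> d3_sum ` tensor3 act" and "t \<in> d3_sum ` tensor3 act"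
    using that by (auto simp: additive.add[OF additive_d3_sum, symmetric] tensor3_closed)
  show "- s \<in> d3_sum ` tensor3 act" if "s \<in> d3_sum ` tensor3 act"
    using that by (auto simp: additive.minus[OF additive_d3_sum, symmetric] tensor_minus)
  show "d3_1 s \<in> d3_sum ` tensor3 act" "d3_2 s \<in> d3_sum ` tensor3 act" if "s \<in> d3_sum ` tensor3 act"
    using that by (auto simp: d3_sum_commute[symmetric] d3_tensor3)
qed

text \<open>
  The three derivations act as \<open>\<partial>\<close>, \<open>\<lambda>\<close> and \<open>\<nu>\<close>, and \<open>\<partial> + \<lambda> + \<nu> = 0\<close>.
\<close>

lemma pair3_image_d3_sum:
  assumes "x \<in> cdual act" "y \<in> cdual act" "t \<in> d3_sum ` tensor3 act"
  shows "pair3 x y t = 0"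
proof -
  have "delv + lamv + nuv = (0 :: 'k poly poly)" by (simp add: nuv_def)
  then show ?thesis
    using assms(3)
    by (auto simp: d3_sum_def pair3_add assms pair3_d3 d3_tensor3 tensor3_closed simp flip: M.scale_left_distrib)
qed

text \<open>
  \<open>unpair v w\<close> sends \<open>\<lambda>\<^sup>n u\<close> to \<open>u \<otimes> \<partial>\<^sup>n v \<otimes> w\<close>; for basis elements \<open>v, w\<close> it undoes, modulo total
  derivatives, the pairing with the dual functionals (\<open>reconstruct\<close>).
\<close>

definition unpair :: "'q \<Rightarrow> 'q \<Rightarrow> 'q poly \<Rightarrow> ('k, 'q) tens3"
  where "unpair v w = psubst (\<lambda>u. tens3 act u v w) d3_2"

lemma unpair_pCons: "unpair v w (pCons u t) = tens3 act u v w + d3_2 (unpair v w t)"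
  unfolding unpair_def by (rule psubst_pCons[OF linear_additive[OF linear_tens3(1)] additive_d(2)])

lemma additive_unpair: "additive (unpair v w)"
  unfolding unpair_def by (rule additive_psubst[OF linear_additive[OF linear_tens3(1)] additive_d(2)])

lemmas unpair_simps = additive_zero[OF additive_unpair] additive.add[OF additive_unpair]
  additive.diff[OF additive_unpair] additive.minus[OF additive_unpair]

lemma unpair_tensor: "unpair v w t \<in> tensor3 act"
  by (induction t) (simp_all add: unpair_simps unpair_pCons tensor3_closed d3_tensor3)

lemma additive_tens3: "additive (\<lambda>a. tens3 act a b c)" "additive (\<lambda>b. tens3 act a b c)" "additive (\<lambda>c. tens3 act a b c)"
  by (rule linear_additive, rule linear_tens3)+

lemma d3_12_commute: "d3_1 (d3_2 t) = d3_2 (d3_1 t)" if "t \<in> tensor3 act"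
  using that by (induction rule: tensor3_induct)
    (simp_all add: additive_zero[OF additive_d(1)] additive_zero[OF additive_d(2)]
      additive.add[OF additive_d(1)] additive.add[OF additive_d(2)] d3_tens3)

lemma d3_32_commute: "d3_3 (d3_2 t) = d3_2 (d3_3 t)" if "t \<in> tensor3 act"
  using that by (induction rule: tensor3_induct)
    (simp_all add: additive_zero[OF additive_d(3)] additive_zero[OF additive_d(2)]
      additive.add[OF additive_d(3)] additive.add[OF additive_d(2)] d3_tens3)

lemma unpair_lam_act:
  "unpair v w (lam_act lamv t) = d3_2 (unpair v w t)"
  "unpair v w (lam_act delv t) = d3_1 (unpair v w t)"
  "unpair v w (lam_act nuv t) = - d3_1 (unpair v w t) - d3_2 (unpair v w t)"
proof -
  show 1: "unpair v w (lam_act lamv t) = d3_2 (unpair v w t)"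
    by (simp add: lam_act_lamv unpair_pCons additive_zero[OF additive_tens3(1)])
  show 2: "unpair v w (lam_act delv t) = d3_1 (unpair v w t)"
    unfolding lam_act_delv
    by (induction t)
      (simp_all add: unpair_simps map_poly_pCons additive_zero[OF additive_der'] unpair_pCons d3_tens3
        additive.add[OF additive_d(1)] additive_zero[OF additive_d(1)] d3_12_commute unpair_tensor)
  show "unpair v w (lam_act nuv t) = - d3_1 (unpair v w t) - d3_2 (unpair v w t)"
    by (simp add: nuv_def M.scale_left_diff_distrib unpair_simps 1 2)
qed

lemma unpair_add: "unpair v (w + w') t = unpair v w t + unpair v w' t"
  by (induction t) (simp_all add: unpair_simps unpair_pCons tens3_add additive.add[OF additive_d(2)])

lemma unpair_smul: "unpair v (smul act c w) t = unpair v w (poly_scale c t)"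
proof -
  have "tens3 act u v (smul act c w) = tens3 act (smul act c u) v w" for u
    using linear_tens3 by (simp add: Vector_Spaces.linear_iff)
  then show ?thesis
    by (induction t) (simp_all add: unpair_simps unpair_pCons map_poly_pCons additive_zero[OF additive_smul])
qed

lemma unpair_0: "unpair v 0 t = 0"
  using unpair_add[of v 0 0 t] by simp

lemma unpair_der: "unpair v (der act w) t = d3_3 (unpair v w t)"
  by (induction t)
    (simp_all add: unpair_simps unpair_pCons d3_tens3 additive_zero[OF additive_d(3)]
      additive.add[OF additive_d(3)] d3_32_commute unpair_tensor)

text \<open>
  Modulo total derivatives \<open>\<partial>\<^sub>3\<close> is \<open>- \<partial>\<^sub>1 - \<partial>\<^sub>2\<close>, the operator to which \<open>unpair\<close> turns \<open>\<nu>\<close>.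
  So \<open>q(\<partial>)\<close> on the third factor can be moved to the polynomial.
\<close>

lemma unpair_lam_act_nuv:
  "unpair v w (lam_act (peval nuv q) t) - unpair v (act q w) t \<in> d3_sum ` tensor3 act"
proof (induction q)
  case 0
  show ?case by (simp add: unpair_simps unpair_0 image_d3_sum_closed)
next
  case (pCons c q)
  let ?s = "unpair v w (lam_act (peval nuv q) t)" and ?h = "unpair v (act q w) t"
  have "unpair v w (lam_act (peval nuv (pCons c q)) t) =
      unpair v w (poly_scale c t) + unpair v w (lam_act nuv (lam_act (peval nuv q) t))"
    by (simp add: peval_pCons M.scale_left_distrib unpair_simps lam_act_const2)
  then have 1: "unpair v w (lam_act (peval nuv (pCons c q)) t) = unpair v w (poly_scale c t) + (- d3_1 ?s - d3_2 ?s)"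
    by (simp only: unpair_lam_act)
  have 2: "unpair v (act (pCons c q) w) t = unpair v w (poly_scale c t) + d3_3 ?h"
    by (simp add: act_pCons module_axioms unpair_add unpair_smul unpair_der)
  \<comment> \<open>the difference is a total derivative plus the image of the induction hypothesis under \<open>- \<partial>\<^sub>1 - \<partial>\<^sub>2\<close>\<close>
  have "unpair v w (lam_act (peval nuv (pCons c q)) t) - unpair v (act (pCons c q) w) t =
      - d3_1 (?s - ?h) + - d3_2 (?s - ?h) + - d3_sum ?h"
    unfolding 1 2 by (simp add: d3_sum_def additive.diff[OF additive_d(1)] additive.diff[OF additive_d(2)])
  also have "\<dots> \<in> d3_sum ` tensor3 act"
    using pCons.IH by (intro image_d3_sum_closed imageI unpair_tensor)
  finally show ?case .
qed

lemma unpair_peval_lamv: "unpair v w (lam_act (peval lamv p) (const1 u)) = tens3 act u (act p v) w"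
proof (induction p)
  case 0
  show ?case by (simp add: unpair_simps additive_zero[OF additive_tens3(2)])
next
  case (pCons c p)
  have "unpair v w (const1 u) = tens3 act u v w" for u
    by (simp add: const1_def unpair_pCons unpair_simps additive_zero[OF additive_d(2)])
  moreover have "poly_scale c (const1 u) = const1 (smul act c u)"
    by (simp add: map_poly_const1 additive_zero[OF additive_smul])
  moreover have "tens3 act u (smul act c v) w = tens3 act (smul act c u) v w"
    using linear_tens3 by (simp add: Vector_Spaces.linear_iff)
  ultimately show ?case using pCons
    by (simp add: peval_pCons M.scale_left_distrib unpair_simps lam_act_const2 act_pCons module_axioms
        tens3_add unpair_lam_act d3_tens3 flip: M.scale_scale)
qed

text \<open>
  Expanding the last two factors of \<open>u \<otimes> v \<otimes> w\<close> in the basis reduces this to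
  \<open>unpair_lam_act_nuv\<close> and \<open>unpair_peval_lamv\<close>.
\<close>

lemma reconstruct:
  assumes C: "finite C" "\<And>m. e m \<in> cdual act" "\<And>v. (\<Sum>m\<in>C. act (e m v) m) = v"
    and t: "t \<in> tensor3 act"
  shows "(\<Sum>m\<in>C. \<Sum>n\<in>C. unpair m n (pair3 (e m) (e n) t)) - t \<in> d3_sum ` tensor3 act"
  using t
proof (induction rule: tensor3_induct)
  case zero
  show ?case by (simp add: pair3_0 C unpair_simps image_d3_sum_closed)
next
  case (add u v w t)
  have v: "tens3 act u v w = (\<Sum>m\<in>C. \<Sum>n\<in>C. tens3 act u (act (e m v) m) (act (e n w) n))"
  proof -
    have "tens3 act u v w = tens3 act u (\<Sum>m\<in>C. act (e m v) m) (\<Sum>n\<in>C. act (e n w) n)"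
      by (simp only: C(3))
    also have "\<dots> = (\<Sum>m\<in>C. tens3 act u (act (e m v) m) (\<Sum>n\<in>C. act (e n w) n))"
      by (rule additive.sum[OF additive_tens3(2)])
    also have "\<dots> = (\<Sum>m\<in>C. \<Sum>n\<in>C. tens3 act u (act (e m v) m) (act (e n w) n))"
      by (simp only: additive.sum[OF additive_tens3(3)])
    finally show ?thesis .
  qed
  have "unpair m n (pair3 (e m) (e n) (tens3 act u v w)) - tens3 act u (act (e m v) m) (act (e n w) n) \<in> d3_sum ` tensor3 act" for m n
  proof -
    have "unpair m n (pair3 (e m) (e n) (tens3 act u v w)) =
      unpair m n (lam_act (peval nuv (e n w)) (lam_act (peval lamv (e m v)) (const1 u)))"
      by (simp add: pair3_tens C pairing_def ev_def mult.commute)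
    then show ?thesis
      using unpair_lam_act_nuv[of m n "e n w" "lam_act (peval lamv (e m v)) (const1 u)"]
      by (simp add: unpair_peval_lamv)
  qed
  moreover have sum: "(\<Sum>m\<in>C. f m) \<in> d3_sum ` tensor3 act" if "\<And>m. f m \<in> d3_sum ` tensor3 act" for f
    using C(1) by (induction) (use that image_d3_sum_closed in auto)
  ultimately have "(\<Sum>m\<in>C. \<Sum>n\<in>C. unpair m n (pair3 (e m) (e n) (tens3 act u v w)) -
      tens3 act u (act (e m v) m) (act (e n w) n)) \<in> d3_sum ` tensor3 act"
    by (intro sum)
  then have "(\<Sum>m\<in>C. \<Sum>n\<in>C. unpair m n (pair3 (e m) (e n) (tens3 act u v w))) - tens3 act u v w \<in> d3_sum ` tensor3 act"
    unfolding sum_subtractf v[symmetric] .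
  from image_d3_sum_closed(2)[OF this add.IH] show ?case
    by (simp only: pair3_add[OF C(2) C(2) tensor3_closed(2) add.hyps] unpair_simps sum.distrib add_diff_add)
qed

text \<open>
  The pairings vanish on total derivatives; conversely, if all of them vanish on \<open>t\<close>, then
  \<open>reconstruct\<close> says that \<open>- t\<close> is a total derivative.
\<close>

lemma image_der3_iff:
  assumes "fg_module act" "free_module act" "t \<in> tensor3 act"
  shows "t \<in> der3 act ` tensor3 act \<longleftrightarrow> (\<forall>x\<in>cdual act. \<forall>y\<in>cdual act. pair3 x y t = 0)"
proof
  assume "t \<in> der3 act ` tensor3 act"
  then show "\<forall>x\<in>cdual act. \<forall>y\<in>cdual act. pair3 x y t = 0"
    using pair3_image_d3_sum by (simp add: image_der3)
next
  assume *: "\<forall>x\<in>cdual act. \<forall>y\<in>cdual act. pair3 x y t = 0"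
  obtain C e where C: "finite C" "\<And>m. e m \<in> cdual act" "\<And>v. (\<Sum>m\<in>C. act (e m v) m) = v"
    using finite_dual_basis[OF assms(1,2)] by metis
  from reconstruct[OF C assms(3)] have "- t \<in> d3_sum ` tensor3 act"
    using * C(2) by (simp add: unpair_simps)
  from image_d3_sum_closed(3)[OF this] show "t \<in> der3 act ` tensor3 act"
    by (simp add: image_der3)
qed

end

section \<open>Both sides of the equation for \<open>\<sigma>\<close>\<close>

sublocale leibniz_conformal_algebra \<subseteq> kd_module act
  by unfold_locales

context leibniz_conformal_algebra
begin

lemma br_add: "br (a + a') b = br a b + br a' b" "br a (b + b') = br a b + br a b'"
  using br_bilinear by (simp_all add: bilinear_map_def Vector_Spaces.linear_iff)

lemma additive_br: "additive (\<lambda>a. br a b)" "additive (br a)"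
  by (simp_all add: additive_def br_add)

lemma br_smul: "br (smul act c a) b = lam_act (const2 c) (br a b)" "br a (smul act c b) = lam_act (const2 c) (br a b)"
  using br_bilinear by (simp_all add: bilinear_map_def Vector_Spaces.linear_iff lam_act_const2)

lemma br_act_left: "br (act p a) b = lam_act (peval (- lamv) p) (br a b)"
  by (rule hom_act[OF module_lam_act])
    (simp_all add: additive_br br_smul br_der_left lam_act_lamv)

lemma br_act_right: "br a (act p b) = lam_act (peval (lamv + delv) p) (br a b)"
  by (rule hom_act[OF module_lam_act])
    (simp_all add: additive_br br_smul br_der_right lam_der_lam_act)

context
  fixes f :: "'q \<Rightarrow> 'k poly"
  assumes f: "f \<in> cdual act"
begin

lemma additive_rsub_ev: "additive (rsub (ev d f) e)"
  by (rule additive_rsub[OF additive_ev[OF f]])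

lemma rsub_ev_br_left: "rsub (ev d f) e (br (act p a) b) = peval (- e) p * rsub (ev d f) e (br a b)"
  using br_bilinear
  by (intro hom_act[OF module_times])
    (simp_all add: additive_def br_add additive.add[OF additive_rsub_ev] br_der_left rsub_ev[OF f]
      bilinear_map_def Vector_Spaces.linear_iff)

lemma rsub_ev_br_right: "rsub (ev d f) e (br a (act p b)) = peval (e + d) p * rsub (ev d f) e (br a b)"
  using br_bilinear
  by (intro hom_act[OF module_times])
    (simp_all add: additive_def br_add additive.add[OF additive_rsub_ev] br_der_right rsub_ev[OF f]
      bilinear_map_def Vector_Spaces.linear_iff)

text \<open>
  In \<open>[b\<^bsub>- e - \<partial>\<^esub> a]\<close> the operator \<open>\<partial>\<close> acts on the coefficients, where \<open>f\<close> reads it as \<open>d\<close>.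
\<close>

lemma rsub_ev_Rop: "rsub (ev d f) e (Rop act br a b) = rsub (ev d f) (- e - d) (br b a)"
proof -
  have "rsub (ev d f) e (Rop act br a b) =
      psubst (\<lambda>z. rsub (ev d f) e (const1 z)) ((*) (- e - d)) (br b a)"
    unfolding Rop_def
    by (rule psubst_transport)
      (simp_all add: additive_poly_ops additive_neg_lam_der additive_der' additive_times
        additive_rsub_ev rsub_ev[OF f])
  then show ?thesis
    by (simp add: rsub_def[of _ "- e - d"] const1_def rsub_pCons additive_ev[OF f])
qed

text \<open>
  The defining property of the dual representations under \<open>\<lambda> \<mapsto> e\<close>, \<open>\<mu> \<mapsto> - \<partial>\<close>, which is the
  specialisation that \<open>\<sigma>(r)\<^sub>0\<close> performs. For \<open>e = \<lambda>\<close> the functional is evaluated at \<open>\<nu>\<close>, for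
  \<open>e = \<nu>\<close> at \<open>\<lambda>\<close>.
\<close>

lemma dual_rep:
  assumes fg: "fg_module act" and \<phi>: "\<phi> \<in> Chom UNIV act act"
  shows "coeff (dual_rep act \<phi> f) n \<in> cdual act"
    and "rsub (\<lambda>g. peval (- delv) (g b)) e (dual_rep act \<phi> f) = - rsub (ev (- delv - e) f) e (\<phi> b)"
proof -
  let ?P = "dual_rep act \<phi> f"
  have P: "(\<forall>n. coeff ?P n \<in> cdual act) \<and>
    (\<forall>b. psubst (\<lambda>g. psubst const2 mul_mu (g b)) mul_lam ?P =
         - psubst (\<lambda>x. psubst const2 (\<lambda>p. mul_mu p - mul_lam p) (f x)) mul_lam (\<phi> b))"
    unfolding dual_rep_def by (rule theI'[OF dual_rep_ex1[OF fg \<phi> f]])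
  then show "coeff ?P n \<in> cdual act" by blast
  have eval: "additive (\<lambda>g :: 'q \<Rightarrow> 'k poly. g b)"
    by (simp add: additive_def plus_fun_apply)
  have i: "additive (\<lambda>x. psubst const2 (\<lambda>p. mul_mu p - mul_lam p) (f x))"
    using f unfolding additive_def cdual_iff by (simp add: psubst_add additive_poly_ops)
  have "map_poly (\<lambda>g. g b) ?P = psubst (\<lambda>g. psubst const2 mul_mu (g b)) mul_lam ?P"
    unfolding psubst_mul_mu by (rule psubst_mul_lam[OF eval, symmetric])
  also have "\<dots> = - psubst (\<lambda>x. psubst const2 (\<lambda>p. mul_mu p - mul_lam p) (f x)) mul_lam (\<phi> b)"
    using P by blast
  finally have m: "map_poly (\<lambda>g. g b) ?P = \<dots>" .
  have "rsub (\<lambda>g. peval (- delv) (g b)) e ?P = rsub (peval (- delv)) e (map_poly (\<lambda>g. g b) ?P)"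
    unfolding rsub_def
    by (rule psubst_map_poly[symmetric]) (simp_all add: additive_peval additive_times eval)
  also have "\<dots> = - rsub (peval (- delv)) e
      (psubst (\<lambda>x. psubst const2 (\<lambda>p. mul_mu p - mul_lam p) (f x)) mul_lam (\<phi> b))"
    unfolding m by (rule additive.minus[OF additive_rsub[OF additive_peval]])
  also have "rsub (peval (- delv)) e
      (psubst (\<lambda>x. psubst const2 (\<lambda>p. mul_mu p - mul_lam p) (f x)) mul_lam (\<phi> b)) =
      rsub (ev (- delv - e) f) e (\<phi> b)"
  proof -
    have "rsub (peval (- delv)) e
      (psubst (\<lambda>x. psubst const2 (\<lambda>p. mul_mu p - mul_lam p) (f x)) mul_lam (\<phi> b)) =
      psubst (\<lambda>x. rsub (peval (- delv)) e (psubst const2 (\<lambda>p. mul_mu p - mul_lam p) (f x))) ((*) e) (\<phi> b)"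
      by (rule psubst_transport)
        (simp_all add: i additive_poly_ops additive_times additive_rsub additive_peval rsub_peval)
    then show ?thesis
      by (simp only: rsub_peval_psubst rsub_def[of "\<lambda>z. ev _ f z"] ev_def)
  qed
  finally show "rsub (\<lambda>g. peval (- delv) (g b)) e ?P = - rsub (ev (- delv - e) f) e (\<phi> b)" .
qed

end

lemma br_sum: "br (sum f I) b = (\<Sum>i\<in>I. br (f i) b)" "br b (sum f I) = (\<Sum>i\<in>I. br b (f i))"
  by (simp_all add: additive.sum[OF additive_br(1)] additive.sum[OF additive_br(2)])

lemma br_sigma0_of:
  "br (sigma0_of I u v x) (sigma0_of J u' v' y) =
    (\<Sum>i\<in>I. \<Sum>j\<in>J. lam_act (ev lamv x (u i) * ev nuv y (u' j)) (br (v i) (v' j)))"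
  unfolding sigma0_of_def br_sum
  by (simp add: br_act_left br_act_right peval_reflect ev_def indet_relations sum.swap[of _ J I]
    mult.commute)

text \<open>
  The scalar \<open>g\<^bsub>- \<partial>\<^esub>\<close> leaves the bracket by sesquilinearity: \<open>- \<partial>\<close> becomes \<open>e\<close> on the left of
  \<open>[\<cdot>\<^sub>e \<cdot>]\<close> and \<open>- e - d\<close> on the right, since \<open>f\<close> turns the outer \<open>\<partial>\<close> into \<open>d\<close>.
\<close>

lemma rsub_br_sigma0_of:
  assumes f: "f \<in> cdual act"
  shows "rsub (ev d f) e (br (sigma0_of I u v g) w) = (\<Sum>i\<in>I. ev e g (u i) * rsub (ev d f) e (br (v i) w))"
    and "rsub (ev d f) e (br w (sigma0_of I u v g)) =
      (\<Sum>i\<in>I. ev (- (e + d)) g (u i) * rsub (ev d f) e (br w (v i)))"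
  by (simp_all add: sigma0_of_def br_sum additive.sum[OF additive_rsub_ev[OF f]] rsub_ev_br_left[OF f]
      rsub_ev_br_right[OF f] peval_reflect ev_def)

text \<open>
  \<open>x\<^sub>\<lambda>([c\<^sub>\<nu> u] + [u\<^sub>\<partial> c])\<close>: up to sign, the value of \<open>(L\<^sup>* + R\<^sup>*)(c)\<^bsub>- \<lambda> - \<partial>\<^esub> x\<close> on \<open>u\<close> with \<open>- \<partial>\<close>
  for its variable.
\<close>

definition dual_sum :: "('q \<Rightarrow> 'k poly) \<Rightarrow> 'q \<Rightarrow> 'q \<Rightarrow> 'k poly poly"
  where "dual_sum x c u = rsub (ev lamv x) nuv (br c u) + rsub (ev lamv x) delv (br u c)"

text \<open>
  The difference of the two sides of the equation for \<open>\<sigma>(t)\<^sub>0\<close>, where \<open>r = \<Sum>\<^sub>i a\<^sub>i \<otimes> b\<^sub>i\<close> and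
  \<open>t = \<Sum>\<^sub>i u\<^sub>i \<otimes> v\<^sub>i\<close>. The three sums come from the bracket, from \<open>L\<^sup>*(\<sigma>(r)\<^sub>0 x)\<^sub>\<lambda> y\<close> and from
  \<open>(L\<^sup>* + R\<^sup>*)(\<sigma>(\<tau> r)\<^sub>0 y)\<^bsub>- \<lambda> - \<partial>\<^esub> x\<close>.
\<close>

definition defect ::
  "'i set \<Rightarrow> ('i \<Rightarrow> 'q) \<Rightarrow> ('i \<Rightarrow> 'q) \<Rightarrow> ('i \<Rightarrow> 'q) \<Rightarrow> ('i \<Rightarrow> 'q) \<Rightarrow>
    ('q \<Rightarrow> 'k poly) \<Rightarrow> ('q \<Rightarrow> 'k poly) \<Rightarrow> 'q poly"
  where "defect I a b u v x y =
    (\<Sum>i\<in>I. \<Sum>j\<in>I. lam_act (ev lamv x (u i) * ev nuv y (u j)) (br (v i) (v j)))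
    + (\<Sum>i\<in>I. \<Sum>j\<in>I.
        lam_act (ev lamv x (a i) * rsub (ev nuv y) lamv (br (b i) (u j))) (const1 (v j)))
    - (\<Sum>i\<in>I. \<Sum>j\<in>I. lam_act (ev nuv y (b i) * dual_sum x (a i) (u j)) (const1 (v j)))"

lemma equation_defect:
  fixes I :: "'i set"
  assumes fg: "fg_module act" and x: "x \<in> cdual act" and y: "y \<in> cdual act"
  shows "br (sigma0_of I u v x) (sigma0_of I u v y) -
      map_poly (sigma0_of I u v) (Lstar act br (sigma0_of I a b x) y -
        psubst const1 (neg_lam_der (der dual_act))
          (Lstar act br (sigma0_of I b a y) x + Rstar act br (sigma0_of I b a y) x)) =
    defect I a b u v x y"
proof -
  have eval: "additive (\<lambda>g. peval (- delv) (g w))" for w :: 'q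
    by (simp add: additive_def peval_add plus_fun_apply)
  have L: "map_poly (sigma0_of J u v) (Lstar act br (sigma0_of I a b x) y) =
    - (\<Sum>i\<in>I. \<Sum>j\<in>J. lam_act (ev lamv x (a i) * rsub (ev nuv y) lamv (br (b i) (u j))) (const1 (v j)))" for J :: "'i set"
    by (simp add: map_sigma0_of Lstar_def dual_rep[OF y fg Lop_Chom] indet_relations Lop_def
        rsub_br_sigma0_of[OF y] M.scale_sum_left sum_negf sum.swap[of _ J I])
  have R: "map_poly (sigma0_of J u v) (psubst const1 (neg_lam_der (der dual_act))
          (Lstar act br (sigma0_of I b a y) x + Rstar act br (sigma0_of I b a y) x)) =
    - (\<Sum>i\<in>I. \<Sum>j\<in>J. lam_act (ev nuv y (b i) * dual_sum x (a i) (u j)) (const1 (v j)))" for J :: "'i set"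
    by (simp add: map_sigma0_of_neg_lam_der Lstar_def Rstar_def dual_rep[OF x fg Lop_Chom]
        dual_rep[OF x fg Rop_Chom] additive.add[OF additive_rsub[OF eval]]
        indet_relations Lop_def rsub_ev_Rop[OF x] rsub_br_sigma0_of[OF x] M.scale_left_diff_distrib
        dual_sum_def M.scale_sum_left sum_negf sum.swap[of _ J I] sum.distrib M.scale_left_distrib distrib_left sum_subtractf)
  show ?thesis
    by (simp add: additive.diff[OF additive_map_poly[OF additive_sigma0_of]] L R br_sigma0_of defect_def)
qed

lemma tau_sum: "finite I \<Longrightarrow> tau act (\<Sum>i\<in>I. tens2 act (a i) (b i)) = (\<Sum>i\<in>I. tens2 act (b i) (a i))"
  unfolding tau_def
  by (rule lift2_sum[where s = tens2_scale]) (simp_all add: bilinear_map_def linear_tens2)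

lemma sigma_equation_iff:
  fixes I :: "'i set"
  assumes fg: "fg_module act" and x: "x \<in> cdual act" and y: "y \<in> cdual act" and I: "finite I"
    and r: "r = (\<Sum>i\<in>I. tens2 act (a i) (b i))" and t: "t = (\<Sum>i\<in>I. tens2 act (u i) (v i))"
  shows "br (sigma0 act t x) (sigma0 act t y) =
      map_poly (sigma0 act t)
        (Lstar act br (sigma0 act r x) y -
         psubst const1 (neg_lam_der (der dual_act))
           (Lstar act br (sigma0 act (tau act r) y) x + Rstar act br (sigma0 act (tau act r) y) x)) \<longleftrightarrow>
    defect I a b u v x y = 0"
proof -
  have s: "sigma0 act r x = sigma0_of I a b x" "sigma0 act (tau act r) y = sigma0_of I b a y"
    unfolding r tau_sum[OF I] by (rule sigma0_sum[OF _ I], fact)+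
  have st: "sigma0 act t g = sigma0_of I u v g" if "g \<in> cdual act" for g
    unfolding t by (rule sigma0_sum[OF that I])
  let ?Q = "Lstar act br (sigma0_of I a b x) y - psubst const1 (neg_lam_der (der dual_act))
      (Lstar act br (sigma0_of I b a y) x + Rstar act br (sigma0_of I b a y) x)"
  have diff: "f - g \<in> cdual act" and add: "f + g \<in> cdual act"
    if "f \<in> cdual act" "g \<in> cdual act" for f g
    using that by (simp_all add: cdual_iff smult_diff_right smult_add_right plus_fun_apply)
  have "coeff ?Q n \<in> cdual act" for n
    unfolding coeff_diff Lstar_def Rstar_def
    by (intro diff coeff_psubst_cdual) (simp_all add: add dual_rep x y fg Lop_Chom Rop_Chom)
  then have "g \<in> cdual act" if "g \<in> set (coeffs ?Q)" for g
    using that by (auto simp: coeffs_def split: if_splits)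
  then have "map_poly (sigma0 act t) ?Q = map_poly (sigma0_of I u v) ?Q"
    by (intro map_poly_cong st)
  then show ?thesis
    unfolding s st[OF x] st[OF y] equation_defect[OF fg x y, symmetric]
    by (simp only: right_minus_eq)
qed

section \<open>The Yang-Baxter expression\<close>

lemma linear_br: "Vector_Spaces.linear (smul act) poly_scale (\<lambda>a. br a b)" "Vector_Spaces.linear (smul act) poly_scale (br a)"
  using br_bilinear by (simp_all add: bilinear_map_def)

text \<open>
  The summand of \<open>[[r, r]]\<close> for \<open>a \<otimes> b\<close> and \<open>a' \<otimes> b'\<close>, with the globally linear derivations, which
  makes its linearity in each argument a formal consequence of the rules above.
\<close>

definition clcybe_term :: "'q \<Rightarrow> 'q \<Rightarrow> 'q \<Rightarrow> 'q \<Rightarrow> ('k, 'q) tens3"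
  where "clcybe_term a b a' b' =
      psubst (\<lambda>x. tens3 act x b b') d3_2 (br a a')
    + psubst (\<lambda>x. tens3 act a a' x) d3_2 (br b' b)
    - psubst (\<lambda>x. tens3 act a x b') d3_1 (br b a')
    - psubst (\<lambda>x. tens3 act a x b') (\<lambda>t. - d3_1 t - d3_2 t) (br a' b)"

lemma linear_neg_d3_12: "Vector_Spaces.linear tens3_scale tens3_scale (\<lambda>t. - d3_1 t - d3_2 t)"
  by (rule linear_addI(2)[OF linear_uminusI[OF linear_d(1)] linear_d(2)])

lemma linear_psubst_br:
  assumes "Vector_Spaces.linear (smul act) tens3_scale i" "Vector_Spaces.linear tens3_scale tens3_scale E"
  shows "Vector_Spaces.linear (smul act) tens3_scale (\<lambda>a. psubst i E (br a b))"
    "Vector_Spaces.linear (smul act) tens3_scale (\<lambda>b. psubst i E (br a b))"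
  by (rule linear_comp[OF linear_psubst[OF assms] linear_br(1)])
   (rule linear_comp[OF linear_psubst[OF assms] linear_br(2)])

lemma bilinear_clcybe_term:
  "bilinear_map act tens3_scale (\<lambda>a b. clcybe_term a b a' b')" "bilinear_map act tens3_scale (\<lambda>a' b'. clcybe_term a b a' b')"
  unfolding bilinear_map_def clcybe_term_def
  by (intro conjI allI linear_addI linear_psubst_br linear_psubst_family linear_tens3 linear_d linear_neg_d3_12 vector_spaces)+

lemma clcybe_eq:
  assumes I: "finite I"
  shows "clcybe act br (\<Sum>i\<in>I. tens2 act (a i) (b i)) = (\<Sum>i\<in>I. \<Sum>j\<in>I. clcybe_term (a i) (b i) (a j) (b j))"
proof -
  note cl = tensor3_closed tensor_minus tensor_diff d3_tensor3
  have *: "psubst i (der3_2 act) p = psubst i d3_2 p" "psubst i (der3_1 act) p = psubst i d3_1 p"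
    "psubst i (\<lambda>t. - der3_1 act t - der3_2 act t) p = psubst i (\<lambda>t. - d3_1 t - d3_2 t) p"
    if "\<And>z. i z \<in> tensor3 act" for i :: "'q \<Rightarrow> ('k, 'q) tens3" and p
    by (rule psubst_cong_on[where S = "tensor3 act"]; simp add: cl der3_eq_d3 that)+
  have "clcybe act br r = lift2 act (\<lambda>a b. lift2 act (clcybe_term a b) r) r" for r
    unfolding clcybe_def clcybe_term_def[abs_def] by (simp add: * cl)
  then show ?thesis
    by (simp add: lift2_sum[OF bilinear_clcybe_term(2) I]
        lift2_sum[where s = tens3_scale and \<beta> = "\<lambda>a' b'. \<Sum>j\<in>I. clcybe_term a' b' (a j) (b j)", OF _ I]
        bilinear_map_def linear_sumI vector_spaces bilinear_clcybe_term(1)[unfolded bilinear_map_def])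
qed

lemma psubst_lam_act:
  "psubst (\<lambda>u. lam_act q (const1 u)) (lam_act lamv) t = lam_act q t"
  "psubst (\<lambda>z. lam_act (ev d f z * q) s) (lam_act e) t = lam_act (rsub (ev d f) e t * q) s" if "f \<in> cdual act"
proof -
  have 1: "additive (\<lambda>u. lam_act q (const1 u))" by (rule linear_additive[OF linear_lam_act_const1])
  have 2: "additive (\<lambda>z. lam_act (ev d f z * q) s)" by (rule linear_additive[OF linear_lam_act_ev(1)[OF that]])
  have c: "pCons a t = const1 a + lam_act lamv t" for a t by (simp add: lam_act_lamv const1_def)
  show "psubst (\<lambda>u. lam_act q (const1 u)) (lam_act lamv) t = lam_act q t"
  proof (induction t)
    case (pCons a t)
    have "lam_act q (lam_act lamv t) = lam_act lamv (lam_act q t)" by (simp add: mult.commute)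
    then show ?case
      using pCons by (simp add: psubst_pCons 1 additive_lam_act) (simp add: c M.scale_right_distrib)
  qed (simp add: psubst_0 1 additive_lam_act)
  show "psubst (\<lambda>z. lam_act (ev d f z * q) s) (lam_act e) t = lam_act (rsub (ev d f) e t * q) s"
    by (induction t)
      (simp_all only: psubst_0 psubst_pCons 2 additive_lam_act rsub_pCons rsub_0 mult_zero_left M.scale_zero_left
        additive_ev[OF that] M.scale_left_distrib distrib_right mult.assoc M.scale_scale)
qed

text \<open>
  The operators \<open>\<partial>\<^sub>2\<close>, \<open>\<partial>\<^sub>1\<close> and \<open>- \<partial>\<^sub>1 - \<partial>\<^sub>2\<close> that are substituted in \<open>[[r, r]]\<close> become \<open>\<lambda>\<close>, \<open>\<partial>\<close> and
  \<open>\<nu>\<close>. The last two terms of \<open>[[r, r]]\<close> combine to \<open>dual_sum\<close>.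
\<close>

lemma pair3_clcybe_term:
  assumes x: "x \<in> cdual act" and y: "y \<in> cdual act"
  shows "clcybe_term a b a' b' \<in> tensor3 act"
   "pair3 x y (clcybe_term a b a' b') =
     lam_act (ev lamv x b * ev nuv y b') (br a a')
     + lam_act (ev lamv x a' * rsub (ev nuv y) lamv (br b' b)) (const1 a)
     - lam_act (ev nuv y b' * dual_sum x a' b) (const1 a)"
proof -
  note cl = tensor3_closed tensor_minus tensor_diff d3_tensor3
  have m: "pair3 x y (- t) = - pair3 x y t" if "t \<in> tensor3 act" for t
    using pair3_diff[OF x y tensor3_closed(1) that] by (simp add: pair3_0 x y)
  have e4: "pair3 x y (- d3_1 t - d3_2 t) = lam_act nuv (pair3 x y t)" if "t \<in> tensor3 act" for t
    using that by (simp add: pair3_diff x y cl m pair3_d3 nuv_def M.scale_left_diff_distrib)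
  note ps = pair3_psubst[OF x y]
  have t: "psubst (\<lambda>x. tens3 act x b b') d3_2 p \<in> tensor3 act"
    "psubst (\<lambda>x. tens3 act a a' x) d3_2 p \<in> tensor3 act"
    "psubst (\<lambda>x. tens3 act a x b') d3_1 p \<in> tensor3 act"
    "psubst (\<lambda>x. tens3 act a x b') (\<lambda>t. - d3_1 t - d3_2 t) p \<in> tensor3 act" for p
    by ((rule ps(2); simp add: cl pair3_d3 x y)+) (rule ps(2)[where e = nuv]; simp add: cl e4)
  have p: "pair3 x y (psubst (\<lambda>x. tens3 act x b b') d3_2 p) = lam_act (ev lamv x b * ev nuv y b') p"
    "pair3 x y (psubst (\<lambda>x. tens3 act a a' x) d3_2 p) = lam_act (ev lamv x a' * rsub (ev nuv y) lamv p) (const1 a)"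
    "pair3 x y (psubst (\<lambda>x. tens3 act a x b') d3_1 p) = lam_act (rsub (ev lamv x) delv p * ev nuv y b') (const1 a)"
    "pair3 x y (psubst (\<lambda>x. tens3 act a x b') (\<lambda>t. - d3_1 t - d3_2 t) p) =
      lam_act (rsub (ev lamv x) nuv p * ev nuv y b') (const1 a)" for p
  proof -
    show "pair3 x y (psubst (\<lambda>x. tens3 act x b b') d3_2 p) = lam_act (ev lamv x b * ev nuv y b') p"
      by (subst ps(1)[where e = lamv])
        (simp_all only: cl pair3_d3 x y pair3_tens pairing_def psubst_lam_act(1)[OF x])
    show "pair3 x y (psubst (\<lambda>x. tens3 act a a' x) d3_2 p) = lam_act (ev lamv x a' * rsub (ev nuv y) lamv p) (const1 a)"
      by (subst ps(1)[where e = lamv])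
        (simp_all only: cl pair3_d3 x y pair3_tens pairing_def psubst_lam_act(2)[OF y] mult.commute[of "ev lamv x a'"])
    show "pair3 x y (psubst (\<lambda>x. tens3 act a x b') d3_1 p) = lam_act (rsub (ev lamv x) delv p * ev nuv y b') (const1 a)"
      by (subst ps(1)[where e = delv])
        (simp_all only: cl pair3_d3 x y pair3_tens pairing_def psubst_lam_act(2)[OF x])
    show "pair3 x y (psubst (\<lambda>x. tens3 act a x b') (\<lambda>t. - d3_1 t - d3_2 t) p) =
      lam_act (rsub (ev lamv x) nuv p * ev nuv y b') (const1 a)"
      by (subst ps(1)[where e = nuv])
        (simp_all only: cl e4 x y pair3_tens pairing_def psubst_lam_act(2)[OF x])
  qed
  show "clcybe_term a b a' b' \<in> tensor3 act"
    unfolding clcybe_term_def by (intro cl t)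
  show "pair3 x y (clcybe_term a b a' b') =
     lam_act (ev lamv x b * ev nuv y b') (br a a')
     + lam_act (ev lamv x a' * rsub (ev nuv y) lamv (br b' b)) (const1 a)
     - lam_act (ev nuv y b' * dual_sum x a' b) (const1 a)"
    unfolding clcybe_term_def
    by (simp add: pair3_diff pair3_add x y cl t p dual_sum_def distrib_left M.scale_left_distrib mult.commute algebra_simps)
qed

text \<open>
  The pairing of \<open>[[r, r]]\<close> with \<open>x, y\<close> is the defect of the equation for \<open>\<tau> r\<close>, after interchanging
  the summation indices in the second and third sum.
\<close>

lemma clcybe_solution_iff:
  fixes I :: "'i set"
  assumes fg: "fg_module act" "free_module act" and I: "finite I"
    and r: "r = (\<Sum>i\<in>I. tens2 act (a i) (b i))"
  shows "clcybe_solution act br r \<longleftrightarrow> (\<forall>x\<in>cdual act. \<forall>y\<in>cdual act. defect I a b b a x y = 0)"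
proof -
  have t: "clcybe act br r \<in> tensor3 act"
    and "pair3 x y (clcybe act br r) = defect I a b b a x y"
    if "x \<in> cdual act" "y \<in> cdual act" for x y
  proof -
    have inner: "(\<Sum>j\<in>I. clcybe_term (a i) (b i) (a j) (b j)) \<in> tensor3 act \<and>
      pair3 x y (\<Sum>j\<in>I. clcybe_term (a i) (b i) (a j) (b j)) = (\<Sum>j\<in>I. pair3 x y (clcybe_term (a i) (b i) (a j) (b j)))" for i
      by (rule pair3_sum[OF that pair3_clcybe_term(1)[OF that]])
    have *: "(\<Sum>i\<in>I. \<Sum>j\<in>I. clcybe_term (a i) (b i) (a j) (b j)) \<in> tensor3 act \<and>
      pair3 x y (\<Sum>i\<in>I. \<Sum>j\<in>I. clcybe_term (a i) (b i) (a j) (b j)) =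
      (\<Sum>i\<in>I. \<Sum>j\<in>I. pair3 x y (clcybe_term (a i) (b i) (a j) (b j)))"
      using pair3_sum[OF that, of I "\<lambda>i. \<Sum>j\<in>I. clcybe_term (a i) (b i) (a j) (b j)"] inner by simp
    then show "clcybe act br r \<in> tensor3 act" by (simp add: r clcybe_eq[OF I])
    show "pair3 x y (clcybe act br r) = defect I a b b a x y"
      unfolding defect_def r clcybe_eq[OF I] conjunct2[OF *] pair3_clcybe_term(2)[OF that] sum_subtractf sum.distrib
      by (intro arg_cong2[where f = minus] arg_cong2[where f = plus] refl sum.swap)
  qed
  \<comment> \<open>\<open>[[r, r]]\<close> was shown to be a tensor for given functionals, so that one functional is needed\<close>
  moreover have "0 \<in> cdual act" by (simp add: cdual_iff zero_fun_apply)
  ultimately show ?thesis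
    unfolding clcybe_solution_def by (subst image_der3_iff[OF fg]) auto
qed

section \<open>Consequences of invariance\<close>

text \<open>
  The value of \<open>F(a)\<close> on \<open>u \<otimes> v\<close>, with the globally linear \<open>\<partial>\<^bsup>\<otimes>2\<^esup>\<close>.
\<close>

definition Fop_term :: "'q \<Rightarrow> 'q \<Rightarrow> 'q \<Rightarrow> ('k, 'q) tens2"
  where "Fop_term a u v =
      psubst (\<lambda>z. tens2 act z v) (\<lambda>t. - d2_sum t) (br a u)
    + psubst (\<lambda>z. tens2 act z v) (\<lambda>t. - d2_sum t) (Rop act br a u)
    - psubst (\<lambda>z. tens2 act u z) (\<lambda>t. - d2_sum t) (Rop act br a v)"

lemma linear_Rop: "Vector_Spaces.linear (smul act) poly_scale (Rop act br a)"
  using Rop_Chom[of a] by (simp add: Chom_def Vector_Spaces.linear_iff vector_spaces)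

lemma bilinear_Fop_term: "bilinear_map act tens2_scale (Fop_term a)"
proof -
  have P: "Vector_Spaces.linear tens2_scale tens2_scale (\<lambda>t. - d2_sum t)"
    by (rule linear_uminusI[OF linear_d(4)])
  have l: "Vector_Spaces.linear (smul act) tens2_scale (\<lambda>u. psubst i (\<lambda>t. - d2_sum t) (br a u))"
    "Vector_Spaces.linear (smul act) tens2_scale (\<lambda>u. psubst i (\<lambda>t. - d2_sum t) (Rop act br a u))"
    if "Vector_Spaces.linear (smul act) tens2_scale i" for i
    by (rule linear_comp[OF linear_psubst[OF that P] linear_br(2)])
      (rule linear_comp[OF linear_psubst[OF that P] linear_Rop])
  show ?thesis
    unfolding bilinear_map_def Fop_term_def
    by (intro conjI allI linear_addI l linear_psubst_family linear_tens2 P vector_spaces)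
qed

lemma Fop_eq: "Fop act br a s = lift2 act (Fop_term a) s"
proof -
  have *: "psubst i (\<lambda>t. - der2 act t) p = psubst i (\<lambda>t. - d2_sum t) p"
    if "\<And>z. i z \<in> tensor2 act" for i :: "'q \<Rightarrow> ('k, 'q) tens2" and p
    by (rule psubst_cong_on[where S = "tensor2 act"])
      (simp_all add: tensor2_closed tensor_minus d2_sum_tensor der2_eq_d2_sum that)
  show ?thesis
    unfolding Fop_def Fop_term_def[abs_def] by (simp add: * tensor2_closed Lop_def)
qed

definition lam_subst :: "'k poly poly \<Rightarrow> 'q poly \<Rightarrow> 'q poly"
  where "lam_subst e = psubst const1 (lam_act e)"

lemma lam_subst_lamv: "lam_subst lamv t = t"
  using psubst_const1 lam_act_lamv by (simp add: lam_subst_def ext[of "lam_act lamv" "pCons 0"])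

lemma lam_subst_pCons: "lam_subst e (pCons u t) = const1 u + lam_act e (lam_subst e t)"
  unfolding lam_subst_def by (rule psubst_pCons[OF additive_poly_ops(3) additive_lam_act])

lemma additive_lam_subst: "additive (lam_subst e)"
  unfolding lam_subst_def by (rule additive_psubst[OF additive_poly_ops(3) additive_lam_act])

lemma lam_subst_delv: "lam_subst e (map_poly (der act) t) = lam_act delv (lam_subst e t)"
proof (induction t)
  case (pCons u t)
  have "const1 (der act u) = lam_act delv (const1 u)"
    by (simp add: lam_act_delv map_poly_const1 additive_zero[OF additive_der'])
  with pCons show ?case
    by (simp add: map_poly_pCons lam_subst_pCons additive_zero[OF additive_der'] M.scale_right_distrib mult.commute)
qed (simp add: additive_zero[OF additive_lam_subst])

lemma lam_subst_Rop: "lam_subst e (Rop act br a v) = lam_subst (- e - delv) (br v a)"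
proof -
  have 1: "lam_subst e (pCons 0 t) = lam_act e (lam_subst e t)" for t
    using lam_subst_pCons[of e 0 t] by (simp add: const1_def)
  have "lam_subst e (neg_lam_der (der act) t) = lam_act (- e - delv) (lam_subst e t)" for t
    unfolding neg_lam_der_def additive.diff[OF additive_lam_subst] additive.minus[OF additive_lam_subst] lam_subst_delv 1
    by (simp add: M.scale_left_diff_distrib)
  then have "lam_subst e (Rop act br a v) = psubst (\<lambda>z. lam_subst e (const1 z)) (lam_act (- e - delv)) (br v a)"
    unfolding Rop_def
    by (intro psubst_transport) (simp_all add: additive_poly_ops additive_neg_lam_der additive_der'
        additive_lam_act additive_lam_subst)
  moreover have "lam_subst e (const1 z) = const1 z" for z
    by (simp only: const1_def lam_subst_pCons additive_zero[OF additive_lam_subst]) simp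
  ultimately show ?thesis by (simp add: lam_subst_def)
qed

text \<open>
  If \<open>\<beta>\<close> turns \<open>\<partial>\<^bsup>\<otimes>2\<^esup>\<close> into \<open>- e\<close>, then the substitution \<open>\<lambda> = - \<partial>\<^bsup>\<otimes>2\<^esup>\<close> in \<open>F(a)\<close> becomes the
  substitution of \<open>e\<close>.
\<close>

lemma tensor2_psubst:
  assumes \<beta>: "bilinear_map act poly_scale \<beta>"
    and der: "\<And>u v. \<beta> (der act u) v + \<beta> u (der act v) = lam_act (- e) (\<beta> u v)"
    and i: "\<And>z. i z \<in> tensor2 act"
  shows "psubst i (\<lambda>t. - d2_sum t) p \<in> tensor2 act"
    "lift2 act \<beta> (psubst i (\<lambda>t. - d2_sum t) p) = psubst (\<lambda>z. lift2 act \<beta> (i z)) (lam_act e) p"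
proof -
  have m: "lift2 act \<beta> (- t) = - lift2 act \<beta> t" if "t \<in> tensor2 act" for t
    using lift2_diff[OF \<beta> tensor2_closed(1) that] by (simp add: lift2_tens(2)[OF \<beta>])
  have "lift2 act \<beta> (d2_sum t) = lam_act (- e) (lift2 act \<beta> t)" if "t \<in> tensor2 act" for t
    using that
    by (induction rule: tensor2_induct)
      (simp_all only: additive_zero[OF additive_d(4)] additive.add[OF additive_d(4)] lift2_tens[OF \<beta>]
        lift2_add[OF \<beta>] tensor2_closed d2_sum_tensor d2_sum_tens der M.scale_zero_right M.scale_right_distrib)
  then show "psubst i (\<lambda>t. - d2_sum t) p \<in> tensor2 act"
    "lift2 act \<beta> (psubst i (\<lambda>t. - d2_sum t) p) = psubst (\<lambda>z. lift2 act \<beta> (i z)) (lam_act e) p"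
    using psubst_transport_on[of "tensor2 act" "\<lambda>t. - d2_sum t" i p "lift2 act \<beta>" "lam_act e"] i
    by (simp_all add: tensor2_closed tensor_minus d2_sum_tensor lift2_add[OF \<beta>] lift2_tens[OF \<beta>] m)
qed

lemma psubst_lam_act_const1: "psubst (\<lambda>z. lam_act q (const1 z)) (lam_act e) t = lam_act q (lam_subst e t)"
proof (induction t)
  case 0
  show ?case by (simp add: psubst_0 linear_additive[OF linear_lam_act_const1] additive_lam_act additive_zero[OF additive_lam_subst])
next
  case (pCons u t)
  then show ?case
    by (simp add: psubst_pCons linear_additive[OF linear_lam_act_const1] additive_lam_act lam_subst_pCons
        M.scale_right_distrib mult.commute)
qed

lemma psubst_lam_act_ev:
  assumes "f \<in> cdual act"
  shows "psubst (\<lambda>z. lam_act (ev d f z) s) (lam_act e) t = lam_act (rsub (ev d f) e t) s"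
  using psubst_lam_act(2)[OF assms, of d 1 s e t] by simp

text \<open>
  The two sides of each identity are the images of \<open>F(c) r\<close> and \<open>F(c) (\<tau> r)\<close> under
  \<open>u \<otimes> v \<mapsto> f\<^sub>d(u) v\<close> for \<open>A\<close> and under \<open>u \<otimes> v \<mapsto> f\<^sub>d(v) u\<close> for \<open>B\<close>. Both maps turn \<open>\<partial>\<^bsup>\<otimes>2\<^esup>\<close>
  into \<open>\<partial> + d\<close>, hence \<open>- \<partial>\<^bsup>\<otimes>2\<^esup>\<close> into \<open>e\<close>. For \<open>d = \<lambda>\<close> this
  is \<open>\<nu>\<close>, and conversely.
\<close>

lemma invariant_pairings:
  fixes c :: 'q and I :: "'i set"
  assumes f: "f \<in> cdual act" and I: "finite I"
    and r: "r = (\<Sum>i\<in>I. tens2 act (a i) (b i))"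
    and inv: "invariant_tensor act br (r - tau act r)"
    and e: "e = - delv - d"
  defines "A \<equiv> \<lambda>u v. lam_act (rsub (ev d f) e (br c u) + rsub (ev d f) delv (br u c)) (const1 v)
      - lam_act (ev d f u) (lam_subst d (br v c))"
    and "B \<equiv> \<lambda>u v. lam_act (ev d f v) (lam_subst e (br c u) + lam_subst d (br u c))
      - lam_act (rsub (ev d f) delv (br v c)) (const1 u)"
  shows "(\<Sum>i\<in>I. A (a i) (b i)) = (\<Sum>i\<in>I. A (b i) (a i))"
    "(\<Sum>i\<in>I. B (a i) (b i)) = (\<Sum>i\<in>I. B (b i) (a i))"
proof -
  have tau: "tau act r = (\<Sum>i\<in>I. tens2 act (b i) (a i))"
    unfolding r by (rule tau_sum[OF I])
  have sum_in: "(\<Sum>i\<in>J. t i) \<in> tensor2 act" if "\<And>i. t i \<in> tensor2 act" for t and J :: "'i set"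
    by (induction J rule: infinite_finite_induct) (use that tensor2_closed in auto)
  have "r \<in> tensor2 act" "tau act r \<in> tensor2 act"
    unfolding tau unfolding r by (rule sum_in, rule tensor2_closed)+
  then have "Fop act br c (r - tau act r) = lift2 act (Fop_term c) r - lift2 act (Fop_term c) (tau act r)"
    unfolding Fop_eq by (rule lift2_diff[OF bilinear_Fop_term])
  also have "\<dots> = (\<Sum>i\<in>I. Fop_term c (a i) (b i)) - (\<Sum>i\<in>I. Fop_term c (b i) (a i))"
    unfolding tau unfolding r by (simp only: lift2_sum[OF bilinear_Fop_term I])
  finally have "Fop act br c (r - tau act r) = \<dots>" .
  then have F: "(\<Sum>i\<in>I. Fop_term c (a i) (b i)) = (\<Sum>i\<in>I. Fop_term c (b i) (a i))"
    using inv by (simp add: invariant_tensor_def)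
  have main: "(\<Sum>i\<in>I. G (a i) (b i)) = (\<Sum>i\<in>I. G (b i) (a i))"
    if \<beta>: "bilinear_map act poly_scale \<beta>" and G: "\<And>u v. Fop_term c u v \<in> tensor2 act"
      "\<And>u v. lift2 act \<beta> (Fop_term c u v) = G u v" for \<beta> G
  proof -
    have "lift2 act \<beta> (\<Sum>i\<in>J. Fop_term c (u i) (v i)) = (\<Sum>i\<in>J. G (u i) (v i))" for u v and J :: "'i set"
      by (induction J rule: infinite_finite_induct)
       (simp_all add: lift2_tens[OF \<beta>] lift2_add[OF \<beta>] G sum_in)
    then show ?thesis using F by metis
  qed
  have de: "- e = d + delv" "- e - d = delv" "- e - delv = d" by (simp_all add: e)
  have cd: "const1 (der act u) = lam_act delv (const1 u)" for u
    by (simp add: lam_act_delv map_poly_const1 additive_zero[OF additive_der'])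
  let ?\<beta> = "\<lambda>u v. lam_act (ev d f u) (const1 v)" and ?\<gamma> = "\<lambda>u v. lam_act (ev d f v) (const1 u)"
  have \<beta>: "bilinear_map act poly_scale ?\<beta>" and \<gamma>: "bilinear_map act poly_scale ?\<gamma>"
    using linear_lam_act_const1 linear_lam_act_ev(3)[OF f] by (auto simp: bilinear_map_def)
  have "?\<beta> (der act u) v + ?\<beta> u (der act v) = lam_act (- e) (?\<beta> u v)"
    "?\<gamma> (der act u) v + ?\<gamma> u (der act v) = lam_act (- e) (?\<gamma> u v)" for u v
    by (simp_all add: de ev_der[OF f] cd distrib_right M.scale_left_distrib mult.commute add.commute)
  note s_beta = tensor2_psubst[OF \<beta> this(1)] and s_gamma = tensor2_psubst[OF \<gamma> this(2)]
  have in2: "Fop_term c u v \<in> tensor2 act" for u v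
    unfolding Fop_term_def by (intro tensor_diff tensor2_closed s_beta)
  show "(\<Sum>i\<in>I. A (a i) (b i)) = (\<Sum>i\<in>I. A (b i) (a i))"
  proof (rule main[OF \<beta> in2])
    show "lift2 act ?\<beta> (Fop_term c u v) = A u v" for u v
      unfolding Fop_term_def A_def
      by (simp add: lift2_diff[OF \<beta>] lift2_add[OF \<beta>] s_beta tensor2_closed lift2_tens[OF \<beta>] psubst_lam_act_ev[OF f]
          psubst_lam_act_const1 lam_subst_Rop rsub_ev_Rop[OF f] de M.scale_left_distrib)
  qed
  show "(\<Sum>i\<in>I. B (a i) (b i)) = (\<Sum>i\<in>I. B (b i) (a i))"
  proof (rule main[OF \<gamma> in2])
    show "lift2 act ?\<gamma> (Fop_term c u v) = B u v" for u v
      unfolding Fop_term_def B_def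
      by (simp add: lift2_diff[OF \<gamma>] lift2_add[OF \<gamma>] s_gamma tensor2_closed lift2_tens[OF \<gamma>] psubst_lam_act_ev[OF f]
          psubst_lam_act_const1 lam_subst_Rop rsub_ev_Rop[OF f] de M.scale_right_distrib)
  qed
qed

lemma invariant_pair_first:
  assumes x: "x \<in> cdual act" and I: "finite I"
    and r: "r = (\<Sum>i\<in>I. tens2 act (a i) (b i))"
    and inv: "invariant_tensor act br (r - tau act r)"
  shows "(\<Sum>i\<in>I. lam_act (dual_sum x c (a i)) (const1 (b i)) - lam_act (ev lamv x (a i)) (br (b i) c)) =
    (\<Sum>i\<in>I. lam_act (dual_sum x c (b i)) (const1 (a i)) - lam_act (ev lamv x (b i)) (br (a i) c))"
  using invariant_pairings(1)[OF x I r inv, of nuv lamv c] by (simp add: nuv_def lam_subst_lamv dual_sum_def)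

text \<open>
  The pairing of \<open>(L(c) \<otimes> id + id \<otimes> L(c)) (r - \<tau> r) = 0\<close> with \<open>y\<^sub>\<nu>\<close> in the second factor.
\<close>

lemma invariant_pair_second:
  assumes y: "y \<in> cdual act" and I: "finite I"
    and r: "r = (\<Sum>i\<in>I. tens2 act (a i) (b i))"
    and inv: "invariant_tensor act br (r - tau act r)"
  shows "(\<Sum>i\<in>I. lam_act (ev nuv y (b i)) (br c (a i)) + lam_act (rsub (ev nuv y) lamv (br c (b i))) (const1 (a i))) =
    (\<Sum>i\<in>I. lam_act (ev nuv y (a i)) (br c (b i)) + lam_act (rsub (ev nuv y) lamv (br c (a i))) (const1 (b i)))"
proof -
  have e: "lamv = - delv - (nuv :: 'k poly poly)" by (simp add: nuv_def)
  let ?X = "\<lambda>u v. \<Sum>i\<in>I. lam_act (ev nuv y (v i)) (br c (u i))"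
    and ?L = "\<lambda>u v. \<Sum>i\<in>I. lam_act (rsub (ev nuv y) lamv (br c (u i))) (const1 (v i))"
    and ?D = "\<lambda>u v. \<Sum>i\<in>I. lam_act (rsub (ev nuv y) delv (br (u i) c)) (const1 (v i))"
    and ?C = "\<lambda>u v. \<Sum>i\<in>I. lam_act (ev nuv y (u i)) (lam_subst nuv (br (v i) c))"
  \<comment> \<open>the terms \<open>?D\<close> and \<open>?C\<close> come from \<open>R(c)\<close>; they cancel in the difference of the two identities,
    which is the pairing of \<open>F(c) s - \<tau> (F(c) s)\<close>\<close>
  have "?L a b + ?D a b - ?C a b = ?L b a + ?D b a - ?C b a"
    and "?X a b + ?C b a - ?D b a = ?X b a + ?C a b - ?D a b"
    using invariant_pairings[OF y I r inv e, of c]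
    by (simp_all add: lam_subst_lamv M.scale_left_distrib M.scale_right_distrib sum.distrib sum_subtractf)
  then have "(?X a b + ?C b a - ?D b a) + (?L b a + ?D b a - ?C b a) =
      (?X b a + ?C a b - ?D a b) + (?L a b + ?D a b - ?C a b)"
    by (simp only:)
  then have "?X a b + ?L b a = ?X b a + ?L a b"
    by simp
  then show ?thesis
    by (simp only: sum.distrib)
qed

text \<open>
  The third sums of the two defects differ by \<open>invariant_pair_first\<close> with \<open>c = a\<^sub>i\<close>, scaled by
  \<open>y\<^sub>\<nu>(b\<^sub>i)\<close>, which trades them for bracket terms. All terms that are left are those of
  \<open>invariant_pair_second\<close> with \<open>c = b\<^sub>i\<close>, scaled by \<open>x\<^sub>\<lambda>(a\<^sub>i)\<close>.
\<close>

lemma defect_tau_eq: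
  fixes I :: "'i set"
  assumes x: "x \<in> cdual act" and y: "y \<in> cdual act" and I: "finite I"
    and r: "r = (\<Sum>i\<in>I. tens2 act (a i) (b i))"
    and inv: "invariant_tensor act br (r - tau act r)"
  shows "defect I a b b a x y = defect I a b a b x y"
proof -
  have 1: "(\<lambda>i. (\<Sum>j\<in>I. lam_act (ev nuv y (b i) * dual_sum x (a i) (a j)) (const1 (b j))) -
      (\<Sum>j\<in>I. lam_act (ev nuv y (b i) * ev lamv x (a j)) (br (b j) (a i)))) =
      (\<lambda>i. (\<Sum>j\<in>I. lam_act (ev nuv y (b i) * dual_sum x (a i) (b j)) (const1 (a j))) -
      (\<Sum>j\<in>I. lam_act (ev nuv y (b i) * ev lamv x (b j)) (br (a j) (a i))))" (is "?L = ?R")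
  proof
    fix i
    show "?L i = ?R i"
      using arg_cong[OF invariant_pair_first[OF x I r inv, of "a i"], of "lam_act (ev nuv y (b i))"]
      by (simp add: M.scale_sum_right M.scale_right_diff_distrib sum_subtractf)
  qed
  have 2: "(\<lambda>i. (\<Sum>j\<in>I. lam_act (ev lamv x (a i) * ev nuv y (b j)) (br (b i) (a j))) +
      (\<Sum>j\<in>I. lam_act (ev lamv x (a i) * rsub (ev nuv y) lamv (br (b i) (b j))) (const1 (a j)))) =
      (\<lambda>i. (\<Sum>j\<in>I. lam_act (ev lamv x (a i) * ev nuv y (a j)) (br (b i) (b j))) +
      (\<Sum>j\<in>I. lam_act (ev lamv x (a i) * rsub (ev nuv y) lamv (br (b i) (a j))) (const1 (b j))))" (is "?L = ?R")
  proof
    fix i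
    show "?L i = ?R i"
      using arg_cong[OF invariant_pair_second[OF y I r inv, of "b i"], of "lam_act (ev lamv x (a i))"]
      by (simp add: M.scale_sum_right M.scale_right_distrib sum.distrib)
  qed
  \<comment> \<open>after interchanging the indices this double sum becomes a bracket term of the two defects\<close>
  have sw: "(\<Sum>i\<in>I. \<Sum>j\<in>I. lam_act (ev nuv y (b i) * ev lamv x (u j)) (br (v j) (a i))) =
      (\<Sum>i\<in>I. \<Sum>j\<in>I. lam_act (ev lamv x (u i) * ev nuv y (b j)) (br (v i) (a j)))" for u v
    by (subst sum.swap) (simp add: mult.commute)
  let ?W1 = "\<Sum>i\<in>I. \<Sum>j\<in>I. lam_act (ev lamv x (b i) * ev nuv y (b j)) (br (a i) (a j))"
    and ?Z = "\<Sum>i\<in>I. \<Sum>j\<in>I. lam_act (ev lamv x (a i) * ev nuv y (b j)) (br (b i) (a j))"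
    and ?K = "\<lambda>u v. \<Sum>i\<in>I. \<Sum>j\<in>I. lam_act (ev nuv y (b i) * dual_sum x (a i) (u j)) (const1 (v j))"
  have cancel: "w - k' = z - k" if "k - z = k' - w" for w k z k' :: "'q poly"
  proof -
    have "w = k' - (k - z)" by (simp add: that)
    then show ?thesis by simp
  qed
  have "?K a b - ?Z = ?K b a - ?W1"
    using arg_cong[OF 1, of "\<lambda>f. sum f I"] unfolding sum_subtractf sw .
  note K = cancel[OF this]
  have "?W1 + w - ?K b a = (?Z + w) - ?K a b" for w
    using K by (simp add: diff_add_eq)
  then show ?thesis
    using arg_cong[OF 2, of "\<lambda>f. sum f I"] unfolding defect_def sum.distrib by (simp only:)
qed

end

section \<open>The characterisation of solutions\<close>

theorem theorem4p9:
  fixes act :: "'k::field_char_0 poly \<Rightarrow> 'q::ab_group_add \<Rightarrow> 'q"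
    and br :: "'q \<Rightarrow> 'q \<Rightarrow> 'q poly"
    and r :: "('k, 'q) tens2"
  assumes "leibniz_conformal_algebra act br"
    and "fg_module act"
    and "free_module act"
    and "r \<in> tensor2 act"
  shows "(clcybe_solution act br r \<longleftrightarrow>
      (\<forall>x\<in>cdual act. \<forall>y\<in>cdual act.
        br (sigma0 act (tau act r) x) (sigma0 act (tau act r) y) =
        map_poly (sigma0 act (tau act r))
          (Lstar act br (sigma0 act r x) y -
           psubst const1 (neg_lam_der (der dual_act))
             (Lstar act br (sigma0 act (tau act r) y) x + Rstar act br (sigma0 act (tau act r) y) x))))
    \<and> (invariant_tensor act br (r - tau act r) \<longrightarrow>
        (clcybe_solution act br r \<longleftrightarrow>
          (\<forall>x\<in>cdual act. \<forall>y\<in>cdual act.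
            br (sigma0 act r x) (sigma0 act r y) =
            map_poly (sigma0 act r)
              (Lstar act br (sigma0 act r x) y -
               psubst const1 (neg_lam_der (der dual_act))
                 (Lstar act br (sigma0 act (tau act r) y) x + Rstar act br (sigma0 act (tau act r) y) x)))))"
proof -
  interpret leibniz_conformal_algebra act br by fact
  obtain n a b where r: "r = (\<Sum>i\<in>{..<n::nat}. tens2 act (a i) (b i))"
    using tensor2_sum[OF assms(4)] by blast
  note solution = clcybe_solution_iff[OF assms(2,3) finite_lessThan r]
  have tau: "tau act r = (\<Sum>i\<in>{..<n}. tens2 act (b i) (a i))"
    unfolding r by (rule tau_sum) simp
  note equation_tau = sigma_equation_iff[OF assms(2) _ _ finite_lessThan r tau]
    and equation = sigma_equation_iff[OF assms(2) _ _ finite_lessThan r r]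
  show ?thesis
    unfolding solution
  proof (intro conjI impI ball_cong refl)
    fix x y
    assume inv: "invariant_tensor act br (r - tau act r)"
      and xy: "x \<in> cdual act" "y \<in> cdual act"
    show "defect {..<n} a b b a x y = 0 \<longleftrightarrow>
        br (sigma0 act r x) (sigma0 act r y) = map_poly (sigma0 act r)
          (Lstar act br (sigma0 act r x) y - psubst const1 (neg_lam_der (der dual_act))
            (Lstar act br (sigma0 act (tau act r) y) x + Rstar act br (sigma0 act (tau act r) y) x))"
      unfolding equation[OF xy] defect_tau_eq[OF xy finite_lessThan r inv] by (rule refl)
  qed (rule equation_tau[symmetric])
qed

end
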